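(* Let $p\in(0,1/2]$ be a fixed constant. There exists a constant $C_p>0$ depending only on $p$ such that the following holds. Let $d,n$ be positive integers with $d=pn$, and let $M$ be a random $n\times n$ matrix drawn uniformly from $\mathcal{M}_{n,d}$. Then for every $\varepsilon>0$, \[ \mathbb{P}\left(s_n(M)\le \frac{\sqrt{d}}{\varepsilon^2 n}\right)\ge 1-C_p\left(\varepsilon+\frac{1}{\sqrt{d}}\right). \]
   Context: For positive integers $d\le n$, $\mathcal{M}_{n,d}$ denotes the set of all $n\times n$ matrices with entries in $\{0,1\}$ in which every row contains exactly $d$ ones; a random matrix drawn uniformly from $\mathcal{M}_{n,d}$ is equivalently one whose rows are independent and each row is uniformly distributed on the set of vectors in $\{0,1\}^n$ with exactly $d$ ones. For an $n\times n$ real matrix $M$, $s_n(M)=\inf_{x\in\mathbb{S}^{n-1}}\|Mx\|_2$ is its smallest singular value, where $\mathbb{S}^{n-1}$ is the Euclidean unit sphere in $\mathbb{R}^n$. *)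

theory Defs
  imports "HOL-Probability.Probability"
begin

definition Mnd :: "nat \<Rightarrow> nat \<Rightarrow> (nat \<Rightarrow> nat \<Rightarrow> real) set" where
  "Mnd n d = {M. (\<forall>i j. M i j \<in> {0, 1}) \<and> (\<forall>i j. (n \<le> i \<or> n \<le> j) \<longrightarrow> M i j = 0)
                 \<and> (\<forall>i<n. card {j. j < n \<and> M i j = 1} = d)}"

definition unit_sphere_n :: "nat \<Rightarrow> (nat \<Rightarrow> real) set" where
  "unit_sphere_n n = {x. (\<forall>j. n \<le> j \<longrightarrow> x j = 0) \<and> (\<Sum>j<n. (x j)\<^sup>2) = 1}"

definition mat_vec_norm :: "nat \<Rightarrow> (nat \<Rightarrow> nat \<Rightarrow> real) \<Rightarrow> (nat \<Rightarrow> real) \<Rightarrow> real" where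
  "mat_vec_norm n M x = sqrt (\<Sum>i<n. (\<Sum>j<n. M i j * x j)\<^sup>2)"

definition smin :: "nat \<Rightarrow> (nat \<Rightarrow> nat \<Rightarrow> real) \<Rightarrow> real" where
  "smin n M = (INF x\<in>unit_sphere_n n. mat_vec_norm n M x)"

end

theory Submission
  imports Defs
begin

text \<open>
  Fix k and let U be the orthogonal complement of the rows with index at least k. A row R_i with i < k
  splits as x_i + \<Sum> c_j R_j with x_i in U, so M^T maps y = e_i - c to x_i and
  s_n(M) \<le> |x_i| / |y|. Since R_i is independent of U, E|x_i|^2 is of order k. The coefficients are
  c_j = <a_j, R_i> for the dual basis a_j of the rows j \<ge> k, where 1 / |a_j| is the distance of R_j to the
  span of the other rows; its mean square is again of order k, so \<Sum> |a_j|^2 is typically at least of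
  order n / k. By Paley--Zygmund a single row satisfies \<Sum> c_j^2 \<ge> c \<Sum> |a_j|^2 with probability bounded
  below, hence some row i < k does, up to an exponentially small probability in k. Markov's inequality
  at level \<epsilon> for both mean squares gives s_n(M) \<le> C k^(3/2) / (\<epsilon> sqrt n), and one takes k of order
  \<epsilon>^(-2/3). No small-ball estimate, hence no control of structured normal vectors, is needed.
\<close>

subsection \<open>Orthogonal residuals and the smallest singular value\<close>

text \<open>The rows have mean p times the all-ones vector, and this threatens the order k of both
  mean squares: the projection of the mean to U could a priori have squared length of order n. It
  does not, because a multiple of the sum of the remaining rows is itself close to the all-ones
  vector (\<open>avg_residual_one\<close>). The power k^(3/2) has a loss built in. The row with
  large coefficients depends on the matrix, so Markov's inequality is applied to the sum of |x_i|^2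
  over all i < k, which is of order k^2; with the factor k from the dual basis this bounds s_n^2 by
  order k^3 / (\<epsilon>^2 n). The power \<epsilon>^2 rather than \<epsilon> in the threshold pays
  for it: k may grow with 1 / \<epsilon>, so that the failure probability (1 - c)^k becomes
  O(\<epsilon>), whereas a fixed k would leave a constant. Singular matrices are favourable, since
  their smallest singular value vanishes, so independence of the rows may be assumed. The term 1 /
  sqrt d keeps k below n / 4.\<close>

definition ip :: "nat \<Rightarrow> (nat \<Rightarrow> real) \<Rightarrow> (nat \<Rightarrow> real) \<Rightarrow> real" where
  "ip n x y = (\<Sum>j<n. x j * y j)"

definition lspan :: "nat \<Rightarrow> 'a set \<Rightarrow> ('a \<Rightarrow> nat \<Rightarrow> real) \<Rightarrow> (nat \<Rightarrow> real) \<Rightarrow> bool" where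
  "lspan n J v x \<longleftrightarrow> (\<exists>c. \<forall>i<n. x i = (\<Sum>l\<in>J. c l * v l i))"

definition indep :: "nat \<Rightarrow> 'a set \<Rightarrow> ('a \<Rightarrow> nat \<Rightarrow> real) \<Rightarrow> bool" where
  "indep n J v \<longleftrightarrow> (\<forall>c. (\<forall>i<n. (\<Sum>l\<in>J. c l * v l i) = 0) \<longrightarrow> (\<forall>l\<in>J. c l = 0))"

definition onb :: "nat \<Rightarrow> 'a set \<Rightarrow> ('a \<Rightarrow> nat \<Rightarrow> real) \<Rightarrow> ('a \<Rightarrow> nat \<Rightarrow> real) \<Rightarrow> bool" where
  "onb n J v q \<longleftrightarrow> (\<forall>l\<in>J. \<forall>k\<in>J. ip n (q l) (q k) = (if l = k then 1 else 0)) \<and>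
     (\<forall>l\<in>J. lspan n J v (q l)) \<and> (\<forall>l\<in>J. lspan n J q (v l))"

text \<open>The component of x orthogonal to the span, meaningful for independent vectors. The basis
  is chosen from a predicate that sees v only on J, so changing vectors outside J leaves the
  residual unchanged (\<open>residual_cong\<close>); this is how independence of rows is exploited
  later.\<close>

definition residual :: "nat \<Rightarrow> 'a set \<Rightarrow> ('a \<Rightarrow> nat \<Rightarrow> real) \<Rightarrow> (nat \<Rightarrow> real) \<Rightarrow> nat \<Rightarrow> real" where
  "residual n J v x = (let q = (SOME q. onb n J v q) in (\<lambda>i. x i - (\<Sum>l\<in>J. ip n x (q l) * q l i)))"

lemma ip_commute: "ip n x y = ip n y x"
  by (simp add: ip_def mult.commute)

lemma ip_cong: "(\<And>i. i < n \<Longrightarrow> x i = x' i) \<Longrightarrow> (\<And>i. i < n \<Longrightarrow> y i = y' i) \<Longrightarrow> ip n x y = ip n x' y'"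
  unfolding ip_def by (rule sum.cong) auto

lemma ip_sum_right: "ip n z (\<lambda>i. \<Sum>l\<in>J. c l * v l i) = (\<Sum>l\<in>J. c l * ip n z (v l))"
proof -
  have "ip n z (\<lambda>i. \<Sum>l\<in>J. c l * v l i) = (\<Sum>i<n. \<Sum>l\<in>J. c l * (z i * v l i))"
    unfolding ip_def by (simp add: sum_distrib_left mult_ac)
  also have "\<dots> = (\<Sum>l\<in>J. \<Sum>i<n. c l * (z i * v l i))"
    by (rule sum.swap)
  finally show ?thesis unfolding ip_def by (simp add: sum_distrib_left)
qed

lemma ip_diff_left: "ip n (\<lambda>i. x i - y i) z = ip n x z - ip n y z"
  by (simp add: ip_def left_diff_distrib sum_subtractf)

lemma ip_diff_right: "ip n z (\<lambda>i. x i - y i) = ip n z x - ip n z y"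
  by (simp add: ip_def right_diff_distrib sum_subtractf)

lemma ip_scale_right: "ip n z (\<lambda>i. c * x i) = c * ip n z x"
  by (simp add: ip_def sum_distrib_left mult_ac)

lemma ip_self_nonneg: "ip n x x \<ge> 0"
  unfolding ip_def by (rule sum_nonneg) simp

lemma ip_self_eq_0: "ip n x x = 0 \<longleftrightarrow> (\<forall>i<n. x i = 0)"
  unfolding ip_def by (subst sum_nonneg_eq_0_iff) auto

lemma ip_Cauchy_Schwarz: "(ip n x y)\<^sup>2 \<le> ip n x x * ip n y y"
  unfolding ip_def using Cauchy_Schwarz_ineq_sum[of x y "{..<n}"] by (simp add: power2_eq_square)

lemma ip_Kronecker_sum:
  assumes "finite J" "\<And>l k. l \<in> J \<Longrightarrow> k \<in> J \<Longrightarrow> ip n (q l) (q k) = (if l = k then 1 else 0)" "k \<in> J"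
  shows "ip n (q k) (\<lambda>i. \<Sum>l\<in>J. c l * q l i) = c k"
proof -
  have "ip n (q k) (\<lambda>i. \<Sum>l\<in>J. c l * q l i) = (\<Sum>l\<in>J. if k = l then c l else 0)"
    unfolding ip_sum_right using assms by (intro sum.cong) auto
  thus ?thesis using assms by simp
qed

lemma lspan_mem: "finite J \<Longrightarrow> l \<in> J \<Longrightarrow> lspan n J v (v l)"
  unfolding lspan_def
  by (rule exI[of _ "\<lambda>k. if k = l then 1 else 0"]) (simp add: mult_if_delta)

lemma lspan_sum:
  assumes "\<And>k. k \<in> K \<Longrightarrow> lspan n J v (f k)"
  shows "lspan n J v (\<lambda>i. \<Sum>k\<in>K. g k * f k i)"
proof -
  obtain c where c: "\<And>k. k \<in> K \<Longrightarrow> \<forall>i<n. f k i = (\<Sum>l\<in>J. c k l * v l i)"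
    using assms unfolding lspan_def by metis
  have "(\<Sum>k\<in>K. g k * f k i) = (\<Sum>l\<in>J. (\<Sum>k\<in>K. g k * c k l) * v l i)" if "i < n" for i
  proof -
    have "(\<Sum>k\<in>K. g k * f k i) = (\<Sum>k\<in>K. \<Sum>l\<in>J. g k * c k l * v l i)"
      using c that by (intro sum.cong) (auto simp: sum_distrib_left mult_ac)
    also have "\<dots> = (\<Sum>l\<in>J. \<Sum>k\<in>K. g k * c k l * v l i)" by (rule sum.swap)
    finally show ?thesis by (simp add: sum_distrib_right)
  qed
  thus ?thesis unfolding lspan_def by (intro exI[of _ "\<lambda>l. \<Sum>k\<in>K. g k * c k l"] allI impI)
qed

lemma lspan_trans:
  assumes "lspan n K w x" "\<And>k. k \<in> K \<Longrightarrow> lspan n J v (w k)"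
  shows "lspan n J v x"
proof -
  obtain c where c: "\<forall>i<n. x i = (\<Sum>l\<in>K. c l * w l i)" using assms(1) unfolding lspan_def by blast
  have "lspan n J v (\<lambda>i. \<Sum>k\<in>K. c k * w k i)" using assms(2) by (rule lspan_sum)
  thus ?thesis using c unfolding lspan_def by simp
qed

lemma lspan_mono:
  assumes "finite K" "J \<subseteq> K" "lspan n J v x" shows "lspan n K v x"
  using assms(1,2) by (auto intro: lspan_trans[OF assms(3) lspan_mem])

lemma lspan_diff:
  assumes "lspan n J v x" "lspan n J v y" shows "lspan n J v (\<lambda>i. x i - a * y i)"
proof -
  obtain c d where "\<forall>i<n. x i = (\<Sum>l\<in>J. c l * v l i)" "\<forall>i<n. y i = (\<Sum>l\<in>J. d l * v l i)"
    using assms unfolding lspan_def by blast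
  hence "\<forall>i<n. x i - a * y i = (\<Sum>l\<in>J. (c l - a * d l) * v l i)"
    by (simp add: left_diff_distrib sum_subtractf sum_distrib_left mult.assoc)
  thus ?thesis unfolding lspan_def by (intro exI[of _ "\<lambda>l. c l - a * d l"])
qed

lemma lspan_orthogonal:
  assumes "lspan n J v x" "\<And>l. l \<in> J \<Longrightarrow> ip n z (v l) = 0"
  shows "ip n z x = 0"
proof -
  obtain c where c: "\<forall>i<n. x i = (\<Sum>l\<in>J. c l * v l i)" using assms(1) unfolding lspan_def by blast
  have "ip n z x = ip n z (\<lambda>i. \<Sum>l\<in>J. c l * v l i)" using c by (intro ip_cong) auto
  thus ?thesis unfolding ip_sum_right using assms(2) by simp
qed

lemma indep_mono:
  assumes "finite K" "J \<subseteq> K" "indep n K v" shows "indep n J v"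
  unfolding indep_def
proof (intro allI impI ballI)
  fix c l assume c: "\<forall>i<n. (\<Sum>l\<in>J. c l * v l i) = 0" and l: "l \<in> J"
  define c' where "c' = (\<lambda>k. if k \<in> J then c k else 0)"
  have "(\<Sum>l\<in>K. c' l * v l i) = (\<Sum>l\<in>J. c l * v l i)" for i
    using assms by (intro sum.mono_neutral_cong_right) (auto simp: c'_def)
  hence "\<forall>l\<in>K. c' l = 0" using assms(3) c unfolding indep_def by auto
  thus "c l = 0" using l assms(2) unfolding c'_def by (metis subsetD)
qed

lemma indep_insert_iff:
  assumes "finite J" "a \<notin> J"
  shows "indep n (insert a J) v \<longleftrightarrow> indep n J v \<and> \<not> lspan n J v (v a)"
proof safe
  assume i: "indep n (insert a J) v"
  thus "indep n J v" using assms by (intro indep_mono[of "insert a J" J]) auto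
  assume "lspan n J v (v a)"
  then obtain c where c: "\<forall>i<n. v a i = (\<Sum>l\<in>J. c l * v l i)" unfolding lspan_def by blast
  define c' where "c' = c(a := -1)"
  have "(\<Sum>l\<in>J. c' l * v l i) = (\<Sum>l\<in>J. c l * v l i)" for i
    using assms by (intro sum.cong) (auto simp: c'_def)
  hence "\<forall>i<n. (\<Sum>l\<in>insert a J. c' l * v l i) = 0" using assms c by (simp add: c'_def)
  hence "c' a = 0" using i unfolding indep_def by blast
  thus False by (simp add: c'_def)
next
  assume i: "indep n J v" and s: "\<not> lspan n J v (v a)"
  show "indep n (insert a J) v" unfolding indep_def
  proof (intro allI impI)
    fix c assume c: "\<forall>i<n. (\<Sum>l\<in>insert a J. c l * v l i) = 0"
    have c2: "c a * v a i + (\<Sum>l\<in>J. c l * v l i) = 0" if "i < n" for i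
      using c that assms by simp
    have "c a = 0"
    proof (rule ccontr)
      assume ca: "c a \<noteq> 0"
      have "v a i = (\<Sum>l\<in>J. (- c l / c a) * v l i)" if "i < n" for i
      proof -
        have "(\<Sum>l\<in>J. (- c l / c a) * v l i) = - (\<Sum>l\<in>J. c l * v l i) / c a"
          by (simp add: sum_divide_distrib sum_negf)
        also have "\<dots> = v a i" using c2[OF that] ca by (simp add: field_simps)
        finally show ?thesis by simp
      qed
      hence "lspan n J v (v a)" unfolding lspan_def by (intro exI[of _ "\<lambda>l. - c l / c a"]) auto
      thus False using s by simp
    qed
    moreover have "\<forall>l\<in>J. c l = 0" using i c2 \<open>c a = 0\<close> unfolding indep_def by auto
    ultimately show "\<forall>l\<in>insert a J. c l = 0" by simp
  qed
qed

lemma spanning_indep_subset: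
  assumes "finite J"
  shows "\<exists>I\<subseteq>J. indep n I v \<and> (\<forall>l\<in>J. lspan n I v (v l))"
  using assms
proof (induction J rule: finite_induct)
  case empty
  show ?case by (auto simp: indep_def)
next
  case (insert a J)
  then obtain I where I: "I \<subseteq> J" "indep n I v" "\<forall>l\<in>J. lspan n I v (v l)" by blast
  have fI: "finite I" using I insert finite_subset by blast
  show ?case
  proof (cases "lspan n I v (v a)")
    case True
    thus ?thesis using I by (intro exI[of _ I]) auto
  next
    case False
    have "a \<notin> I" using I insert by auto
    hence "indep n (insert a I) v" using False I fI by (simp add: indep_insert_iff)
    moreover have "lspan n (insert a I) v (v l)" if "l \<in> insert a J" for l
    proof (cases "l = a")
      case True thus ?thesis using fI by (auto intro!: lspan_mem)
    next
      case False
      thus ?thesis using that I fI by (intro lspan_mono[of "insert a I" I]) auto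
    qed
    ultimately show ?thesis using I by (intro exI[of _ "insert a I"]) auto
  qed
qed

lemma Gram_Schmidt:
  assumes "finite J" "indep n J v"
  shows "\<exists>q. onb n J v q"
  using assms
proof (induction J rule: finite_induct)
  case empty
  show ?case by (auto simp: onb_def)
next
  case (insert a J)
  hence ind: "indep n J v" and ns: "\<not> lspan n J v (v a)" by (auto simp: indep_insert_iff)
  obtain q where "onb n J v q" using insert ind by blast
  hence q1: "\<And>l k. l \<in> J \<Longrightarrow> k \<in> J \<Longrightarrow> ip n (q l) (q k) = (if l = k then 1 else 0)"
    and q2: "\<And>l. l \<in> J \<Longrightarrow> lspan n J v (q l)" and q3: "\<And>l. l \<in> J \<Longrightarrow> lspan n J q (v l)"
    by (auto simp: onb_def)
  define g where "g = (\<lambda>i. \<Sum>l\<in>J. ip n (v a) (q l) * q l i)"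
  define w where "w = (\<lambda>i. v a i - g i)"
  have g: "lspan n J v g" unfolding g_def by (rule lspan_sum) (rule q2)
  have wpos: "ip n w w > 0"
  proof (rule ccontr)
    assume "\<not> ip n w w > 0"
    hence "ip n w w = 0" using ip_self_nonneg[of n w] by linarith
    hence "\<forall>i<n. v a i = g i" unfolding ip_self_eq_0 w_def by auto
    thus False using g ns unfolding lspan_def by auto
  qed
  define e where "e = (\<lambda>i. (1 / sqrt (ip n w w)) * w i)"
  define q' where "q' = q(a := e)"
  have wq: "ip n (q l) w = 0" if "l \<in> J" for l
    unfolding w_def ip_diff_right g_def
    using ip_Kronecker_sum[OF insert.hyps(1) q1 that, of "\<lambda>l. ip n (v a) (q l)"]
    by (simp add: ip_commute)
  have eq0: "ip n (q l) e = 0" if "l \<in> J" for l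
    unfolding e_def ip_scale_right using wq[OF that] by simp
  hence eq0': "ip n e (q l) = 0" if "l \<in> J" for l using that by (subst ip_commute) auto
  have ee: "ip n e e = 1"
  proof -
    have "ip n e e = (1 / sqrt (ip n w w)) * ip n e w"
      using ip_scale_right[of n e "1 / sqrt (ip n w w)" w] by (simp only: e_def[symmetric])
    also have "ip n e w = (1 / sqrt (ip n w w)) * ip n w w"
      using ip_scale_right[of n w "1 / sqrt (ip n w w)" w] by (simp only: e_def[symmetric] ip_commute)
    finally show ?thesis using wpos by (simp add: field_simps)
  qed
  have qq: "q' l = q l" if "l \<in> J" for l using that insert.hyps by (auto simp: q'_def)
  have "onb n (insert a J) v q'"
    unfolding onb_def
  proof (intro conjI ballI)
    fix l k assume "l \<in> insert a J" "k \<in> insert a J"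
    thus "ip n (q' l) (q' k) = (if l = k then 1 else 0)"
      using insert.hyps q1 eq0 eq0' ee by (auto simp: q'_def)
  next
    fix l assume l: "l \<in> insert a J"
    have 1: "lspan n (insert a J) v (q k)" if "k \<in> J" for k
      using insert.hyps q2 that by (intro lspan_mono[of "insert a J" J]) auto
    have "lspan n (insert a J) v w"
      unfolding w_def using lspan_diff[of n "insert a J" v "v a" g 1]
        lspan_mem[of "insert a J" a n v] lspan_mono[of "insert a J" J n v g] insert.hyps g by auto
    hence "lspan n (insert a J) v e"
      using lspan_sum[of "{a}" n "insert a J" v "\<lambda>_. w" "\<lambda>_. 1 / sqrt (ip n w w)"]
      by (simp add: e_def)
    thus "lspan n (insert a J) v (q' l)" using 1 l qq by (cases "l = a") (auto simp: q'_def)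
  next
    fix l assume l: "l \<in> insert a J"
    have m: "lspan n (insert a J) q' (q' k)" if "k \<in> insert a J" for k
      using that insert.hyps by (intro lspan_mem) auto
    have 1: "lspan n (insert a J) q' (q k)" if "k \<in> J" for k
      using m[of k] that qq by auto
    have g': "lspan n (insert a J) q' g" unfolding g_def by (rule lspan_sum) (rule 1)
    have "lspan n (insert a J) q' (\<lambda>i. g i - (- sqrt (ip n w w)) * e i)"
      using m[of a] by (intro lspan_diff g') (simp add: q'_def)
    hence "lspan n (insert a J) q' (v a)" using wpos by (simp add: e_def w_def)
    moreover have "lspan n (insert a J) q' (v l)" if "l \<in> J"
      using q3[OF that] 1 by (rule lspan_trans)
    ultimately show "lspan n (insert a J) q' (v l)" using l by auto
  qed
  thus ?case by blast
qed

lemma residual_onb: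
  assumes "finite J" "indep n J v"
  obtains q where "onb n J v q" "\<And>x. residual n J v x = (\<lambda>i. x i - (\<Sum>l\<in>J. ip n x (q l) * q l i))"
proof -
  have "onb n J v (SOME q. onb n J v q)" using Gram_Schmidt[OF assms] by (rule someI_ex)
  thus ?thesis by (intro that[of "SOME q. onb n J v q"]) (auto simp: residual_def Let_def)
qed

lemma residual_cong:
  assumes "\<And>l. l \<in> J \<Longrightarrow> v l = v' l"
  shows "residual n J v = residual n J v'" and "indep n J v = indep n J v'"
proof -
  have "lspan n J v = lspan n J v'" unfolding lspan_def using assms by (intro ext) simp
  hence "onb n J v = onb n J v'" unfolding onb_def using assms by (intro ext) simp
  thus "residual n J v = residual n J v'" unfolding residual_def by (intro ext) simp
  show "indep n J v = indep n J v'" unfolding indep_def using assms by simp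
qed

lemma residual_orthogonal:
  assumes "finite J" "indep n J v" "l \<in> J"
  shows "ip n (residual n J v x) (v l) = 0"
proof -
  obtain q where q: "onb n J v q" and r: "\<And>x. residual n J v x = (\<lambda>i. x i - (\<Sum>l\<in>J. ip n x (q l) * q l i))"
    by (rule residual_onb[OF assms(1,2)]) (rule that)
  have "ip n (residual n J v x) (q k) = 0" if "k \<in> J" for k
  proof -
    have "ip n (q k) (\<lambda>i. \<Sum>l\<in>J. ip n x (q l) * q l i) = ip n x (q k)"
      by (rule ip_Kronecker_sum) (use q assms(1) that in \<open>simp_all add: onb_def\<close>)
    hence "ip n (q k) (residual n J v x) = 0"
      unfolding r ip_diff_right using ip_commute[of n "q k" x] by simp
    thus ?thesis by (subst ip_commute)
  qed
  thus ?thesis using q assms(3) unfolding onb_def by (metis lspan_orthogonal)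
qed

lemma lspan_residual:
  assumes "finite J" "indep n J v"
  shows "lspan n J v (\<lambda>i. x i - residual n J v x i)"
proof -
  obtain q where q: "onb n J v q" and r: "\<And>x. residual n J v x = (\<lambda>i. x i - (\<Sum>l\<in>J. ip n x (q l) * q l i))"
    by (rule residual_onb[OF assms(1,2)]) (rule that)
  have "lspan n J v (\<lambda>i. (\<Sum>l\<in>J. ip n x (q l) * q l i))"
    using q by (intro lspan_sum) (auto simp: onb_def)
  thus ?thesis by (simp add: r)
qed

lemma norm_residual:
  assumes "finite J" "onb n J v q" "\<And>x. residual n J v x = (\<lambda>i. x i - (\<Sum>l\<in>J. ip n x (q l) * q l i))"
  shows "ip n (residual n J v x) (residual n J v x) = ip n x x - (\<Sum>l\<in>J. (ip n x (q l))\<^sup>2)"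
proof -
  define g where "g = (\<lambda>i. \<Sum>l\<in>J. ip n x (q l) * q l i)"
  have qg: "ip n (q k) g = ip n x (q k)" if "k \<in> J" for k
    unfolding g_def
    by (rule ip_Kronecker_sum) (use assms(1,2) that in \<open>simp_all add: onb_def\<close>)
  have xg: "ip n x g = (\<Sum>l\<in>J. (ip n x (q l))\<^sup>2)"
    unfolding g_def ip_sum_right by (simp add: power2_eq_square)
  have "ip n g g = (\<Sum>l\<in>J. ip n x (q l) * ip n g (q l))"
    by (subst (2) g_def) (simp add: ip_sum_right)
  also have "\<dots> = (\<Sum>l\<in>J. (ip n x (q l))\<^sup>2)"
    by (intro sum.cong refl) (metis power2_eq_square ip_commute qg)
  finally have gg: "ip n g g = (\<Sum>l\<in>J. (ip n x (q l))\<^sup>2)" .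
  have "ip n (residual n J v x) (residual n J v x) = ip n (\<lambda>i. x i - g i) (\<lambda>i. x i - g i)"
    by (simp add: assms(3) g_def)
  also have "\<dots> = ip n x x - ip n x g - (ip n g x - ip n g g)"
    by (simp add: ip_diff_left ip_diff_right)
  finally show ?thesis using xg gg ip_commute[of n g x] by simp
qed

text \<open>Serves to bound the distance of the all-ones vector from a span by exhibiting a single
  vector y of that span.\<close>

lemma residual_minimal:
  assumes "finite J" "indep n J v" "lspan n J v y"
  shows "ip n (residual n J v x) (residual n J v x) \<le> ip n (\<lambda>i. x i - y i) (\<lambda>i. x i - y i)"
proof -
  define r where "r = residual n J v x"
  define h where "h = (\<lambda>i. (x i - r i) - 1 * y i)"
  have "lspan n J v h" unfolding h_def r_def
    using assms by (intro lspan_diff lspan_residual) auto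
  hence rh: "ip n r h = 0"
    by (rule lspan_orthogonal) (use assms in \<open>auto simp: r_def intro: residual_orthogonal\<close>)
  have "(\<lambda>i. x i - y i) = (\<lambda>i. r i + h i)" by (simp add: h_def)
  hence "ip n (\<lambda>i. x i - y i) (\<lambda>i. x i - y i) = ip n (\<lambda>i. r i + h i) (\<lambda>i. r i + h i)" by simp
  also have "\<dots> = ip n r r + 2 * ip n r h + ip n h h"
    by (simp add: ip_def sum.distrib algebra_simps sum_distrib_left)
  finally show ?thesis using rh ip_self_nonneg[of n h] by (simp add: r_def)
qed

lemma residual_pos:
  assumes "finite J" "a \<notin> J" "indep n (insert a J) v"
  shows "ip n (residual n J v (v a)) (residual n J v (v a)) > 0"
proof (rule ccontr)
  assume "\<not> ?thesis"
  hence "ip n (residual n J v (v a)) (residual n J v (v a)) = 0"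
    using ip_self_nonneg[of n "residual n J v (v a)"] by linarith
  hence "\<forall>i<n. residual n J v (v a) i = 0" by (simp add: ip_self_eq_0)
  moreover have i: "indep n J v" "\<not> lspan n J v (v a)" using assms by (auto simp: indep_insert_iff)
  ultimately show False using lspan_residual[OF assms(1) i(1), of "v a"] unfolding lspan_def by auto
qed

text \<open>The squared residuals of the standard basis vectors sum to n - card J.\<close>

lemma exists_orthogonal:
  assumes "finite J" "card J < n" "indep n J v"
  shows "\<exists>z. ip n z z > 0 \<and> (\<forall>l\<in>J. ip n z (v l) = 0)"
proof -
  obtain q where q: "onb n J v q" and r: "\<And>x. residual n J v x = (\<lambda>i. x i - (\<Sum>l\<in>J. ip n x (q l) * q l i))"
    by (rule residual_onb[OF assms(1,3)]) (rule that)
  define e :: "nat \<Rightarrow> nat \<Rightarrow> real" where "e = (\<lambda>a i. if i = a then 1 else 0)"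
  have ee: "ip n (e a) x = x a" if "a < n" for a x
    unfolding ip_def e_def using that by (simp add: mult_if_delta)
  have e1: "e a a = 1" for a by (simp add: e_def)
  have "(\<Sum>a<n. ip n (residual n J v (e a)) (residual n J v (e a))) = (\<Sum>a<n. 1 - (\<Sum>l\<in>J. (q l a)\<^sup>2))"
    unfolding norm_residual[OF assms(1) q r] by (intro sum.cong) (simp_all add: ee e1)
  also have "\<dots> = real n - (\<Sum>a<n. (\<Sum>l\<in>J. (q l a)\<^sup>2))" by (simp add: sum_subtractf)
  also have "(\<Sum>a<n. (\<Sum>l\<in>J. (q l a)\<^sup>2)) = (\<Sum>l\<in>J. ip n (q l) (q l))"
    by (subst sum.swap) (simp add: ip_def power2_eq_square)
  also have "\<dots> = card J" using q by (simp add: onb_def)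
  finally have "(\<Sum>a<n. ip n (residual n J v (e a)) (residual n J v (e a))) > 0" using assms by simp
  then obtain a where "ip n (residual n J v (e a)) (residual n J v (e a)) > 0"
    by (metis (no_types, lifting) sum_nonpos not_le)
  thus ?thesis using residual_orthogonal[OF assms(1,3)] by blast
qed

section \<open>Upper bounds for the smallest singular value from test vectors\<close>

lemma smin_le:
  assumes "ip n z z > 0" "(\<Sum>i<n. (ip n (M i) z)\<^sup>2) \<le> s\<^sup>2 * ip n z z" "s \<ge> 0"
  shows "smin n M \<le> s"
proof -
  define t where "t = sqrt (ip n z z)"
  have t: "t > 0" "t\<^sup>2 = ip n z z" using assms by (auto simp: t_def)
  define u where "u = (\<lambda>j. if j < n then z j / t else 0)"
  have "(\<Sum>j<n. (u j)\<^sup>2) = (\<Sum>j<n. z j * z j / t\<^sup>2)"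
    by (intro sum.cong) (auto simp: u_def power_divide power2_eq_square)
  also have "\<dots> = 1" using t assms(1) by (simp add: sum_divide_distrib[symmetric] ip_def)
  finally have u: "u \<in> unit_sphere_n n" by (auto simp: unit_sphere_n_def u_def)
  have "(\<Sum>j<n. M i j * u j) = ip n (M i) z / t" for i
    by (simp add: ip_def u_def sum_divide_distrib)
  hence "mat_vec_norm n M u = sqrt (\<Sum>i<n. (ip n (M i) z)\<^sup>2 / t\<^sup>2)"
    by (simp add: mat_vec_norm_def power_divide)
  also have "\<dots> = sqrt ((\<Sum>i<n. (ip n (M i) z)\<^sup>2) / t\<^sup>2)" by (simp add: sum_divide_distrib)
  also have "\<dots> \<le> sqrt (s\<^sup>2)"
    using assms t by (intro real_sqrt_le_mono) (simp add: divide_le_eq)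
  finally have "mat_vec_norm n M u \<le> s" using assms by simp
  moreover have "bdd_below (mat_vec_norm n M ` unit_sphere_n n)"
    by (rule bdd_belowI[of _ 0]) (auto simp: mat_vec_norm_def intro!: sum_nonneg)
  ultimately show ?thesis unfolding smin_def using u by (meson cINF_lower order_trans)
qed

text \<open>An independent subset spanning all rows has fewer than n members, so some nonzero z is
  orthogonal to it and hence to every row. This disposes of singular matrices.\<close>

lemma smin_dependent_rows:
  assumes "\<not> indep n {..<n} M"
  shows "smin n M \<le> 0"
proof -
  obtain I where I: "I \<subseteq> {..<n}" "indep n I M" "\<forall>l<n. lspan n I M (M l)"
    using spanning_indep_subset[of "{..<n}" n M] by auto
  have "I \<subset> {..<n}" using I assms by auto
  hence "card I < n" "finite I" using psubset_card_mono[of "{..<n}" I] by (auto simp: finite_subset)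
  then obtain z where z: "ip n z z > 0" "\<forall>l\<in>I. ip n z (M l) = 0"
    using exists_orthogonal I by blast
  have "ip n z (M l) = 0" if "l < n" for l
    using that I z by (metis lspan_orthogonal)
  thus ?thesis using z by (intro smin_le[of n z]) (auto simp: ip_commute)
qed

text \<open>Transposition: with z the solution of M z = y one has |y|^2 = <x, z>.\<close>

lemma smin_le_transpose:
  assumes ind: "indep n {..<n} M" and s: "s \<ge> 0"
    and y: "(\<Sum>l<n. (y l)\<^sup>2) > 0"
    and le: "ip n (\<lambda>i. \<Sum>l<n. y l * M l i) (\<lambda>i. \<Sum>l<n. y l * M l i) \<le> s\<^sup>2 * (\<Sum>l<n. (y l)\<^sup>2)"
  shows "smin n M \<le> s"
proof -
  define w where "w = (\<lambda>j. residual n ({..<n} - {j}) M (M j))"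
  have ind': "indep n ({..<n} - {j}) M" for j by (rule indep_mono[OF _ _ ind]) auto
  have wM: "ip n (w j) (M l) = (if l = j then ip n (w j) (w j) else 0)" if "j < n" "l < n" for j l
  proof (cases "l = j")
    case False
    thus ?thesis using that ind' by (simp add: w_def residual_orthogonal)
  next
    case True
    have "ip n (w j) (\<lambda>i. M j i - w j i) = 0"
    proof (rule lspan_orthogonal)
      show "lspan n ({..<n} - {j}) M (\<lambda>i. M j i - w j i)"
        unfolding w_def using ind' by (intro lspan_residual) auto
      show "ip n (w j) (M l) = 0" if "l \<in> {..<n} - {j}" for l
        unfolding w_def using ind' that by (intro residual_orthogonal) auto
    qed
    thus ?thesis using True by (simp add: ip_diff_right)
  qed
  have wpos: "ip n (w j) (w j) > 0" if "j < n" for j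
    unfolding w_def using ind that by (intro residual_pos) (auto simp: insert_absorb)
  \<comment> \<open>By \<open>wM\<close>, \<open>w j\<close> divided by its squared length is column
    j of the inverse of M, so z is M^-1 y.\<close>
  define z where "z = (\<lambda>i. \<Sum>j<n. (y j / ip n (w j) (w j)) * w j i)"
  have Mz: "ip n (M l) z = y l" if "l < n" for l
  proof -
    have "ip n (M l) z = (\<Sum>j<n. (y j / ip n (w j) (w j)) * ip n (M l) (w j))"
      unfolding z_def by (rule ip_sum_right)
    also have "\<dots> = (\<Sum>j<n. if l = j then y j else 0)"
      using wpos that by (intro sum.cong) (auto simp: ip_commute[of n "M l"] wM less_le)
    finally show ?thesis using that by simp
  qed
  define x where "x = (\<lambda>i. \<Sum>l<n. y l * M l i)"
  define Y where "Y = (\<Sum>l<n. (y l)\<^sup>2)"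
  have "ip n z x = Y" unfolding x_def ip_sum_right Y_def
    by (intro sum.cong) (auto simp: ip_commute[of n z] Mz power2_eq_square)
  \<comment> \<open>Cauchy-Schwarz moves the estimate from the transpose to M: dividing by Y > 0
    leaves |M z|^2 = Y \<le> s^2 |z|^2.\<close>
  hence "Y\<^sup>2 \<le> ip n z z * ip n x x" using ip_Cauchy_Schwarz[of n z x] by simp
  also have "\<dots> \<le> ip n z z * (s\<^sup>2 * Y)"
    using le ip_self_nonneg[of n z] unfolding x_def Y_def by (intro mult_left_mono)
  finally have "Y * Y \<le> (s\<^sup>2 * ip n z z) * Y" by (simp add: power2_eq_square mult_ac)
  hence *: "Y \<le> s\<^sup>2 * ip n z z" using y unfolding Y_def by (simp add: mult_le_cancel_right)
  have "ip n z z > 0"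
  proof (rule ccontr)
    assume "\<not> ?thesis"
    hence "ip n z z = 0" using ip_self_nonneg[of n z] by linarith
    thus False using * y unfolding Y_def by simp
  qed
  moreover have "(\<Sum>i<n. (ip n (M i) z)\<^sup>2) = Y" unfolding Y_def using Mz by simp
  ultimately show ?thesis using * s by (intro smin_le[of n z]) auto
qed

subsection \<open>Moments of linear forms in a random row\<close>

text \<open>Expectation under the uniform law of a finite set. Probabilities are averages of 0/1
  functions until the end of \<open>prob_smin_le\<close>, so symmetry and independence become
  reindexings of finite sums.\<close>

definition avg :: "'a set \<Rightarrow> ('a \<Rightarrow> real) \<Rightarrow> real" where
  "avg S f = (\<Sum>x\<in>S. f x) / real (card S)"

lemma avg_add: "avg S (\<lambda>x. f x + g x) = avg S f + avg S g"
  by (simp add: avg_def sum.distrib add_divide_distrib)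

lemma avg_diff: "avg S (\<lambda>x. f x - g x) = avg S f - avg S g"
  by (simp add: avg_def sum_subtractf diff_divide_distrib)

lemma avg_cmult: "avg S (\<lambda>x. c * f x) = c * avg S f"
  by (simp add: avg_def sum_distrib_left[symmetric])

lemma avg_sum: "avg S (\<lambda>x. \<Sum>i\<in>I. f i x) = (\<Sum>i\<in>I. avg S (f i))"
  unfolding avg_def sum_divide_distrib[symmetric] by (subst sum.swap) simp

lemma avg_mono: "(\<And>x. x \<in> S \<Longrightarrow> f x \<le> g x) \<Longrightarrow> avg S f \<le> avg S g"
  unfolding avg_def by (intro divide_right_mono sum_mono) auto

lemma avg_cong: "(\<And>x. x \<in> S \<Longrightarrow> f x = g x) \<Longrightarrow> avg S f = avg S g"
  unfolding avg_def by simp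

lemma avg_const: "finite S \<Longrightarrow> S \<noteq> {} \<Longrightarrow> avg S (\<lambda>_. c) = c"
  by (simp add: avg_def)

section \<open>Rows with d ones and their symmetry under swaps\<close>

definition rowset :: "nat \<Rightarrow> nat \<Rightarrow> (nat \<Rightarrow> real) set" where
  "rowset n d = {r. (\<forall>j. r j \<in> {0, 1}) \<and> (\<forall>j\<ge>n. r j = 0) \<and> (\<Sum>j<n. r j) = real d}"

lemma sum_01_eq_card:
  fixes n :: nat
  assumes "\<forall>j. r j \<in> {0, 1 :: real}"
  shows "(\<Sum>j<n. r j) = real (card {j. j < n \<and> r j = 1})"
proof -
  have "(\<Sum>j<n. r j) = (\<Sum>j | j < n \<and> r j = 1. 1)"
    using assms by (intro sum.mono_neutral_cong_right) auto
  thus ?thesis by simp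
qed

text \<open>The product structure behind the independence of the rows; the default 0 covers row
  indices from n on.\<close>

lemma Mnd_eq: "Mnd n d = PiE_dflt {..<n} (\<lambda>_. 0) (\<lambda>_. rowset n d)"
proof (intro set_eqI iffI)
  fix M assume M: "M \<in> Mnd n d"
  thus "M \<in> PiE_dflt {..<n} (\<lambda>_. 0) (\<lambda>_. rowset n d)"
    by (auto simp: PiE_dflt_def Mnd_def rowset_def fun_eq_iff sum_01_eq_card)
next
  fix M :: "nat \<Rightarrow> nat \<Rightarrow> real" assume "M \<in> PiE_dflt {..<n} (\<lambda>_. 0) (\<lambda>_. rowset n d)"
  hence 1: "\<And>i. i < n \<Longrightarrow> M i \<in> rowset n d" and 2: "\<And>i j. \<not> i < n \<Longrightarrow> M i j = 0"
    by (auto simp: PiE_dflt_def)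
  have 3: "M i j \<in> {0, 1}" for i j using 1[of i] 2[of i j] by (cases "i < n") (auto simp: rowset_def)
  have 4: "card {j. j < n \<and> M i j = 1} = d" if "i < n" for i
    using 1[OF that] sum_01_eq_card[of "M i" n] by (auto simp: rowset_def)
  show "M \<in> Mnd n d" unfolding Mnd_def using 1 2 3 4 by (auto simp: rowset_def)
qed

lemma finite_rowset: "finite (rowset n d)"
proof (rule finite_subset)
  show "rowset n d \<subseteq> (\<lambda>S j. if j \<in> S then 1 else 0) ` Pow {..<n}"
  proof
    fix r assume r: "r \<in> rowset n d"
    hence "r = (\<lambda>j. if j \<in> {j. j < n \<and> r j = 1} then 1 else 0)"
      by (fastforce simp: rowset_def fun_eq_iff not_less)
    thus "r \<in> (\<lambda>S j. if j \<in> S then 1 else 0) ` Pow {..<n}" by (rule image_eqI) auto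
  qed
qed auto

lemma rowset_nonempty:
  assumes "d \<le> n" shows "rowset n d \<noteq> {}"
proof -
  have "(\<Sum>j<n. if j < d then 1 else 0 :: real) = (\<Sum>j<d. 1)"
    using assms by (intro sum.mono_neutral_cong_right) auto
  hence "(\<lambda>j. if j < d then 1 else 0) \<in> rowset n d" using assms by (auto simp: rowset_def)
  thus ?thesis by blast
qed

text \<open>A swap changes r by -(r i - r j) (e_i - e_j). Together r and its swap form an
  exchangeable pair, from which all moments below are computed.\<close>

lemma ip_transpose:
  assumes "i < n" "j < n"
  shows "ip n a (r \<circ> Transposition.transpose i j) = ip n a r - (a i - a j) * (r i - r j)"
proof -
  define e :: "nat \<Rightarrow> nat \<Rightarrow> real" where "e = (\<lambda>i k. if k = i then 1 else 0)"
  have e: "ip n a (e i) = a i" if "i < n" for i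
    unfolding ip_def e_def using that by (simp add: if_distrib[of "\<lambda>x. _ * x"] cong: if_cong)
  have "ip n a (r \<circ> Transposition.transpose i j) = ip n a (\<lambda>k. r k - (r i - r j) * (e i k - e j k))"
    by (intro ip_cong) (auto simp: e_def Transposition.transpose_def)
  thus ?thesis using e assms by (simp add: ip_diff_right ip_scale_right mult.commute)
qed

lemma transpose_rows:
  assumes "i < n" "j < n" "r \<in> rowset n d"
  shows "r \<circ> Transposition.transpose i j \<in> rowset n d"
proof -
  have "Transposition.transpose i j permutes {..<n}" using assms by (intro permutes_swap_id) auto
  hence "(\<Sum>k<n. r (Transposition.transpose i j k)) = (\<Sum>k<n. r k)" by (rule sum.permute[symmetric, unfolded o_def])
  thus ?thesis using assms by (auto simp: rowset_def Transposition.transpose_def)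
qed

lemma avg_transpose:
  assumes "i < n" "j < n"
  shows "avg (rowset n d) (\<lambda>r. f (r \<circ> Transposition.transpose i j)) = avg (rowset n d) f"
proof -
  have "(\<Sum>r\<in>rowset n d. f (r \<circ> Transposition.transpose i j)) = (\<Sum>r\<in>rowset n d. f r)"
    by (rule sum.reindex_bij_witness[of _ "\<lambda>r. r \<circ> Transposition.transpose i j" "\<lambda>r. r \<circ> Transposition.transpose i j"])
       (use transpose_rows[OF assms] in \<open>auto simp: o_assoc[symmetric]\<close>)
  thus ?thesis by (simp add: avg_def)
qed

lemma sum_sq_diff:
  fixes a :: "nat \<Rightarrow> real"
  assumes "(\<Sum>i<n. a i) = 0"
  shows "(\<Sum>i<n. \<Sum>j<n. (a i - a j)\<^sup>2) = 2 * real n * ip n a a"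
proof -
  have "(\<Sum>i<n. \<Sum>j<n. (a i - a j)\<^sup>2) = (\<Sum>i<n. \<Sum>j<n. (a i * a i) * 1 + 1 * (a j * a j) + (- 2 * a i) * a j)"
    by (intro sum.cong refl) (simp add: power2_eq_square algebra_simps)
  also have "\<dots> = ip n a a * real n + real n * ip n a a + (\<Sum>i<n. - 2 * a i) * (\<Sum>i<n. a i)"
    unfolding sum.distrib sum_product[symmetric] ip_def by simp
  finally show ?thesis using assms by simp
qed

text \<open>For centred a, the total drift over all swaps is proportional to the linear form itself;
  this is what makes the moment equations close.\<close>

lemma sum_swap_increments:
  fixes a r :: "nat \<Rightarrow> real"
  assumes "(\<Sum>i<n. a i) = 0"
  shows "(\<Sum>i<n. \<Sum>j<n. (a i - a j) * (r i - r j)) = 2 * real n * ip n a r"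
proof -
  have "(\<Sum>i<n. \<Sum>j<n. (a i - a j) * (r i - r j)) =
    (\<Sum>i<n. \<Sum>j<n. (a i * r i) * 1 + 1 * (a j * r j) + (- a i) * r j + (- r i) * a j)"
    by (intro sum.cong refl) (simp add: algebra_simps)
  also have "\<dots> = ip n a r * real n + real n * ip n a r + (\<Sum>i<n. - a i) * (\<Sum>i<n. r i) + (\<Sum>i<n. - r i) * (\<Sum>i<n. a i)"
    unfolding sum.distrib sum_product[symmetric] ip_def by simp
  finally show ?thesis using assms by (simp add: sum_negf)
qed

lemma sum_swap_increments_sq:
  fixes a r :: "nat \<Rightarrow> real"
  assumes a: "(\<Sum>i<n. a i) = 0" and r: "r \<in> rowset n d"
  shows "(\<Sum>i<n. \<Sum>j<n. ((a i - a j) * (r i - r j))\<^sup>2) =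
    2 * (real n - 2 * real d) * ip n (\<lambda>i. (a i)\<^sup>2) r + 2 * real d * ip n a a + 4 * (ip n a r)\<^sup>2"
proof -
  have r2: "r i * r i = r i" for i
  proof -
    have "r i = 0 \<or> r i = 1" using r by (auto simp: rowset_def)
    thus ?thesis by auto
  qed
  have rs: "(\<Sum>i<n. r i) = d" using r by (simp add: rowset_def)
  define A where "A = ip n (\<lambda>i. (a i)\<^sup>2) r"
  define X where "X = ip n a r"
  \<comment> \<open>Every summand is written as a function of i times a function of j, so that
    \<open>sum_product\<close> factors the double sums; r i squared has been replaced by r
    i.\<close>
  have "((a i - a j) * (r i - r j))\<^sup>2 =
      ((a i)\<^sup>2 * r i) * 1 + (a i)\<^sup>2 * r j + (- 2 * ((a i)\<^sup>2 * r i)) * r j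
      + (- 2 * (a i * r i)) * a j + (- 2 * a i) * (a j * r j) + (4 * (a i * r i)) * (a j * r j)
      + r i * (a j)\<^sup>2 + 1 * ((a j)\<^sup>2 * r j) + (- 2 * r i) * ((a j)\<^sup>2 * r j)" for i j
  proof -
    have "((a i - a j) * (r i - r j))\<^sup>2 = (a i - a j)\<^sup>2 * (r i * r i + r j * r j - 2 * r i * r j)"
      by (simp add: power2_eq_square algebra_simps)
    thus ?thesis unfolding r2 by (simp add: power2_eq_square algebra_simps)
  qed
  hence "(\<Sum>i<n. \<Sum>j<n. ((a i - a j) * (r i - r j))\<^sup>2) = (\<Sum>i<n. \<Sum>j<n.
      ((a i)\<^sup>2 * r i) * 1 + (a i)\<^sup>2 * r j + (- 2 * ((a i)\<^sup>2 * r i)) * r j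
      + (- 2 * (a i * r i)) * a j + (- 2 * a i) * (a j * r j) + (4 * (a i * r i)) * (a j * r j)
      + r i * (a j)\<^sup>2 + 1 * ((a j)\<^sup>2 * r j) + (- 2 * r i) * ((a j)\<^sup>2 * r j))"
    by presburger
  also have "\<dots> = A * real n + ip n a a * real d + (- 2 * A) * real d
      + (- 2 * X) * (\<Sum>i<n. a i) + (- 2 * (\<Sum>i<n. a i)) * X + (4 * X) * X
      + real d * ip n a a + real n * A + (- 2 * real d) * A"
    unfolding sum.distrib sum_product[symmetric] A_def X_def ip_def rs[symmetric] sum_distrib_left
    by (simp add: power2_eq_square)
  finally show ?thesis using a unfolding A_def[symmetric] X_def[symmetric]
    by (simp add: power2_eq_square algebra_simps)
qed

context
  fixes n d :: nat
  assumes d: "0 < d" "2 * d \<le> n"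
begin

text \<open>The eigenvalue of the covariance matrix of a row on vectors with coordinate sum zero. It
  exceeds p (1 - p) slightly, by the factor n / (n - 1), since the entries of a row are negatively
  correlated.\<close>

definition row_var :: real where "row_var = real d * (real n - real d) / (real n * (real n - 1))"

lemma n2: "n \<ge> 2" using d by simp

lemma avg_rows_const: "avg (rowset n d) (\<lambda>_. c) = c"
  using d by (intro avg_const finite_rowset rowset_nonempty) auto

lemma avg_entry:
  assumes "i < n" shows "avg (rowset n d) (\<lambda>r. r i) = real d / real n"
proof -
  have eq: "avg (rowset n d) (\<lambda>r. r j) = avg (rowset n d) (\<lambda>r. r i)" if "j < n" for j
    using avg_transpose[OF assms that, of d "\<lambda>r. r i"] by simp
  have "real n * avg (rowset n d) (\<lambda>r. r i) = (\<Sum>j<n. avg (rowset n d) (\<lambda>r. r j))"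
    using eq by simp
  also have "\<dots> = avg (rowset n d) (\<lambda>r. \<Sum>j<n. r j)" by (simp add: avg_sum)
  also have "\<dots> = avg (rowset n d) (\<lambda>r. real d)" by (rule avg_cong) (simp add: rowset_def)
  finally show ?thesis using n2 by (simp add: avg_rows_const field_simps)
qed

lemma avg_ip: "avg (rowset n d) (ip n a) = (\<Sum>i<n. a i) * (real d / real n)"
proof -
  have "avg (rowset n d) (ip n a) = (\<Sum>i<n. avg (rowset n d) (\<lambda>r. a i * r i))"
    by (simp add: ip_def avg_sum[symmetric] cong: avg_cong)
  also have "\<dots> = (\<Sum>i<n. a i * (real d / real n))"
    by (intro sum.cong) (auto simp: avg_cmult avg_entry)
  finally show ?thesis by (simp add: sum_distrib_right sum_divide_distrib)
qed

lemma row_var_bounds: "real d / real n * (1 - real d / real n) \<le> row_var" "0 \<le> row_var" "row_var \<le> 1"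
  "real d / (2 * real n) \<le> row_var"
proof -
  have rd: "1 \<le> real d" "2 * real d \<le> real n" "2 \<le> real n" using d by linarith+
  have "real d / real n * (1 - real d / real n) = real d * (real n - real d) / (real n * real n)"
    using rd by (simp add: field_simps)
  also have "\<dots> \<le> row_var" unfolding row_var_def using rd by (intro divide_left_mono mult_left_mono) auto
  finally show 1: "real d / real n * (1 - real d / real n) \<le> row_var" .
  have "real d / real n * (1 / 2) \<le> real d / real n * (1 - real d / real n)"
    using rd by (intro mult_left_mono) (auto simp: field_simps)
  thus "real d / (2 * real n) \<le> row_var" using 1 by simp
  thus "0 \<le> row_var" using rd by (smt (verit) divide_nonneg_nonneg)
  have "row_var = (real d / real n) * ((real n - real d) / (real n - 1))" by (simp add: row_var_def)
  also have "\<dots> \<le> 1 * 1" using rd by (intro mult_mono) auto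
  finally show "row_var \<le> 1" by simp
qed

text \<open>Swapping two coordinates preserves the law of a row; F = square and F = fourth power then give
  equations for the moments of a linear form.\<close>

lemma avg_swap_sum:
  fixes F :: "real \<Rightarrow> real"
  shows "avg (rowset n d) (\<lambda>r. \<Sum>i<n. \<Sum>j<n. F (ip n a r - (a i - a j) * (r i - r j)) - F (ip n a r)) = 0"
proof -
  have "avg (rowset n d) (\<lambda>r. F (ip n a r - (a i - a j) * (r i - r j)) - F (ip n a r)) = 0"
    if "i < n" "j < n" for i j
    using avg_transpose[OF that, of d "\<lambda>r. F (ip n a r)"] that
    by (simp add: avg_diff ip_transpose)
  thus ?thesis by (simp add: avg_sum)
qed

lemma second_moment_centred:
  assumes a: "(\<Sum>i<n. a i) = 0"
  shows "avg (rowset n d) (\<lambda>r. (ip n a r)\<^sup>2) = row_var * ip n a a"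
proof -
  define P where "P = ip n a a"
  have rd: "1 \<le> real d" "2 * real d \<le> real n" "2 \<le> real n" using d by linarith+
  have "0 = avg (rowset n d) (\<lambda>r. \<Sum>i<n. \<Sum>j<n. (ip n a r - (a i - a j) * (r i - r j))\<^sup>2 - (ip n a r)\<^sup>2)"
    using avg_swap_sum[of "\<lambda>x. x\<^sup>2" a] by simp
  \<comment> \<open>The drift contributes -4 n <a, r>^2 and the squared increments return 4 <a,
    r>^2.\<close>
  also have "\<dots> = avg (rowset n d) (\<lambda>r. (4 - 4 * real n) * (ip n a r)\<^sup>2
      + 2 * (real n - 2 * real d) * ip n (\<lambda>i. (a i)\<^sup>2) r + 2 * real d * P)"
  proof (rule avg_cong)
    fix r assume r: "r \<in> rowset n d"
    have "(\<Sum>i<n. \<Sum>j<n. (ip n a r - (a i - a j) * (r i - r j))\<^sup>2 - (ip n a r)\<^sup>2) =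
      (\<Sum>i<n. \<Sum>j<n. ((a i - a j) * (r i - r j))\<^sup>2 + (- 2 * ip n a r) * ((a i - a j) * (r i - r j)))"
      by (intro sum.cong refl) (simp add: power2_eq_square algebra_simps)
    also have "\<dots> = (\<Sum>i<n. \<Sum>j<n. ((a i - a j) * (r i - r j))\<^sup>2)
        + (- 2 * ip n a r) * (\<Sum>i<n. \<Sum>j<n. (a i - a j) * (r i - r j))"
      by (simp only: sum.distrib sum_distrib_left)
    also have "\<dots> = (4 - 4 * real n) * (ip n a r)\<^sup>2
      + 2 * (real n - 2 * real d) * ip n (\<lambda>i. (a i)\<^sup>2) r + 2 * real d * P"
      unfolding sum_swap_increments_sq[OF a r] sum_swap_increments[OF a] P_def
      by (simp add: power2_eq_square algebra_simps)
    finally show "(\<Sum>i<n. \<Sum>j<n. (ip n a r - (a i - a j) * (r i - r j))\<^sup>2 - (ip n a r)\<^sup>2) = \<dots>" .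
  qed
  also have "\<dots> = (4 - 4 * real n) * avg (rowset n d) (\<lambda>r. (ip n a r)\<^sup>2)
     + 2 * (real n - 2 * real d) * (P * (real d / real n)) + 2 * real d * P"
  proof -
    have "avg (rowset n d) (ip n (\<lambda>i. (a i)\<^sup>2)) = P * (real d / real n)"
      unfolding avg_ip P_def ip_def by (simp add: power2_eq_square)
    thus ?thesis unfolding avg_add avg_cmult avg_rows_const by simp
  qed
  finally have "4 * ((real n - 1) * avg (rowset n d) (\<lambda>r. (ip n a r)\<^sup>2)) =
      2 * (real n - 2 * real d) * (P * (real d / real n)) + 2 * real d * P"
    by (simp add: algebra_simps)
  also have "\<dots> = 4 * (real d * (real n - real d) / real n * P)"
    using rd by (simp add: field_simps)
  finally have "(real n - 1) * avg (rowset n d) (\<lambda>r. (ip n a r)\<^sup>2) = real d * (real n - real d) / real n * P"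
    by linarith
  thus ?thesis using rd unfolding row_var_def P_def by (simp add: field_simps)
qed

text \<open>The drift of the fourth power is -8 n X^4, so the fourth moment is controlled by the
  second. The constant is 5 = (16 + 24) / 8, after bounding \<open>row_var\<close> by 1.\<close>

lemma fourth_moment_centred:
  assumes a: "(\<Sum>i<n. a i) = 0"
  shows "avg (rowset n d) (\<lambda>r. (ip n a r) ^ 4) \<le> 5 * (ip n a a)\<^sup>2"
proof -
  define P where "P = ip n a a"
  have P0: "P \<ge> 0" unfolding P_def by (rule ip_self_nonneg)
  have aP: "(a i)\<^sup>2 \<le> P" if "i < n" for i
    unfolding P_def ip_def using that member_le_sum[of i "{..<n}" "\<lambda>i. a i * a i"]
    by (simp add: power2_eq_square)
  have rd: "1 \<le> real d" "2 * real d \<le> real n" "2 \<le> real n" using d by linarith+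
  have "0 = avg (rowset n d) (\<lambda>r. \<Sum>i<n. \<Sum>j<n. (ip n a r - (a i - a j) * (r i - r j)) ^ 4 - (ip n a r) ^ 4)"
    using avg_swap_sum[of "\<lambda>x. x ^ 4" a] by simp
  also have "\<dots> \<le> avg (rowset n d) (\<lambda>r. (- 8 * real n) * (ip n a r) ^ 4
      + 16 * real n * P * (ip n a r)\<^sup>2 + 24 * real n * P\<^sup>2)"
  proof (rule avg_mono)
    fix r assume r: "r \<in> rowset n d"
    define X where "X = ip n a r"
    have le: "(X - (a i - a j) * (r i - r j)) ^ 4 - X ^ 4 \<le>
        (- 4 * X ^ 3) * ((a i - a j) * (r i - r j)) + (8 * X\<^sup>2 + 12 * P) * (a i - a j)\<^sup>2"
      if "i < n" "j < n" for i j
    proof -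
      define t where "t = (a i - a j) * (r i - r j)"
      have "r i \<in> {0,1}" "r j \<in> {0,1}" using r by (auto simp: rowset_def)
      hence "(r i - r j)\<^sup>2 \<le> 1" by auto
      hence t2: "t\<^sup>2 \<le> (a i - a j)\<^sup>2" unfolding t_def power_mult_distrib
        by (simp add: mult_left_le)
      have "(a i - a j)\<^sup>2 \<le> 2 * (a i)\<^sup>2 + 2 * (a j)\<^sup>2"
        using zero_le_power2[of "a i + a j"] by (simp add: power2_eq_square algebra_simps)
      hence aa: "(a i - a j)\<^sup>2 \<le> 4 * P" using aP that by (smt (verit))
      have t4: "t ^ 4 \<le> 4 * P * (a i - a j)\<^sup>2"
      proof -
        have "t ^ 4 = t\<^sup>2 * t\<^sup>2" by (simp add: power_numeral_reduce)
        also have "\<dots> \<le> (4 * P) * (a i - a j)\<^sup>2" using t2 aa P0 by (intro mult_mono) auto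
        finally show ?thesis .
      qed
      \<comment> \<open>The term -4 X t^3 has no sign; it is absorbed into the subtracted square,
        leaving only even powers besides the drift.\<close>
      have "(X - t) ^ 4 - X ^ 4 = - 4 * X ^ 3 * t + 8 * X\<^sup>2 * t\<^sup>2 + 3 * t ^ 4 - 2 * (t * (X + t))\<^sup>2"
        by (simp add: power_numeral_reduce algebra_simps)
      also have "\<dots> \<le> - 4 * X ^ 3 * t + 8 * X\<^sup>2 * t\<^sup>2 + 3 * t ^ 4" by simp
      also have "\<dots> \<le> - 4 * X ^ 3 * t + 8 * X\<^sup>2 * (a i - a j)\<^sup>2 + 3 * (4 * P * (a i - a j)\<^sup>2)"
        using t4 mult_left_mono[OF t2, of "8 * X\<^sup>2"] by simp
      finally show ?thesis unfolding t_def by (simp add: algebra_simps)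
    qed
    have "(\<Sum>i<n. \<Sum>j<n. (X - (a i - a j) * (r i - r j)) ^ 4 - X ^ 4) \<le>
      (\<Sum>i<n. \<Sum>j<n. (- 4 * X ^ 3) * ((a i - a j) * (r i - r j)) + (8 * X\<^sup>2 + 12 * P) * (a i - a j)\<^sup>2)"
      using le by (intro sum_mono) auto
    also have "\<dots> = (- 4 * X ^ 3) * (\<Sum>i<n. \<Sum>j<n. (a i - a j) * (r i - r j))
        + (8 * X\<^sup>2 + 12 * P) * (\<Sum>i<n. \<Sum>j<n. (a i - a j)\<^sup>2)"
      by (simp only: sum.distrib sum_distrib_left)
    also have "\<dots> = (- 8 * real n) * X ^ 4 + 16 * real n * P * X\<^sup>2 + 24 * real n * P\<^sup>2"
      unfolding sum_swap_increments[OF a] sum_sq_diff[OF a] P_def[symmetric] X_def[symmetric]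
      by (simp add: power_numeral_reduce algebra_simps)
    finally show "(\<Sum>i<n. \<Sum>j<n. (ip n a r - (a i - a j) * (r i - r j)) ^ 4 - (ip n a r) ^ 4) \<le>
        (- 8 * real n) * (ip n a r) ^ 4 + 16 * real n * P * (ip n a r)\<^sup>2 + 24 * real n * P\<^sup>2"
      unfolding X_def .
  qed
  also have "\<dots> = (- 8 * real n) * avg (rowset n d) (\<lambda>r. (ip n a r) ^ 4) + 16 * real n * P * (row_var * P) + 24 * real n * P\<^sup>2"
    unfolding avg_add avg_cmult avg_rows_const second_moment_centred[OF a] P_def ..
  also have "\<dots> \<le> (- 8 * real n) * avg (rowset n d) (\<lambda>r. (ip n a r) ^ 4) + 16 * real n * P * (1 * P) + 24 * real n * P\<^sup>2"
  proof -
    have "16 * real n * P * (row_var * P) \<le> 16 * real n * P * (1 * P)"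
      using row_var_bounds P0 by (intro mult_left_mono mult_right_mono) auto
    thus ?thesis by simp
  qed
  also have "\<dots> = 8 * real n * (5 * P\<^sup>2 - avg (rowset n d) (\<lambda>r. (ip n a r) ^ 4))"
    by (simp add: power2_eq_square algebra_simps)
  finally have "0 \<le> 5 * P\<^sup>2 - avg (rowset n d) (\<lambda>r. (ip n a r) ^ 4)" using rd by (simp add: zero_le_mult_iff)
  thus ?thesis unfolding P_def by simp
qed

text \<open>All rows have the same coordinate sum, so the constant part of a contributes a
  deterministic mean and only the centred part fluctuates.\<close>

lemma centring:
  defines "s \<equiv> \<lambda>a. \<Sum>i<n. a i"
  shows "(\<Sum>i<n. a i - s a / real n) = 0"
    and "r \<in> rowset n d \<Longrightarrow> ip n a r = s a * (real d / real n) + ip n (\<lambda>i. a i - s a / real n) r"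
    and "ip n (\<lambda>i. a i - s a / real n) (\<lambda>i. a i - s a / real n) = ip n a a - (s a)\<^sup>2 / real n"
proof -
  have n: "real n > 0" using n2 by simp
  show "(\<Sum>i<n. a i - s a / real n) = 0" using n by (simp add: sum_subtractf s_def)
  show "ip n a r = s a * (real d / real n) + ip n (\<lambda>i. a i - s a / real n) r" if "r \<in> rowset n d"
  proof -
    have "ip n (\<lambda>_. s a / real n) r = s a / real n * real d"
      using that by (simp add: ip_def rowset_def sum_distrib_left[symmetric] del: times_divide_eq_left)
    thus ?thesis by (simp add: ip_diff_left)
  qed
  define k where "k = s a / real n"
  have sk: "s a = real n * k" using n by (simp add: k_def)
  have "ip n (\<lambda>i. a i - k) (\<lambda>i. a i - k) = (\<Sum>i<n. a i * a i - (2 * k) * a i + k\<^sup>2)"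
    unfolding ip_def by (intro sum.cong) (auto simp: power2_eq_square algebra_simps)
  also have "\<dots> = ip n a a - 2 * k * s a + real n * k\<^sup>2"
    unfolding sum.distrib sum_subtractf sum_distrib_left[symmetric] ip_def s_def by simp
  also have "\<dots> = ip n a a - (s a)\<^sup>2 / real n"
    unfolding sk using n by (simp add: power2_eq_square field_simps)
  finally show "ip n (\<lambda>i. a i - s a / real n) (\<lambda>i. a i - s a / real n) = ip n a a - (s a)\<^sup>2 / real n"
    unfolding k_def .
qed

lemma second_moment:
  "avg (rowset n d) (\<lambda>r. (ip n a r)\<^sup>2) =
    (\<Sum>i<n. a i)\<^sup>2 * (real d / real n)\<^sup>2 + row_var * (ip n a a - (\<Sum>i<n. a i)\<^sup>2 / real n)"
proof -
  define m where "m = (\<Sum>i<n. a i) * (real d / real n)"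
  define c where "c = (\<lambda>i. a i - (\<Sum>i<n. a i) / real n)"
  have "avg (rowset n d) (\<lambda>r. (ip n a r)\<^sup>2) = avg (rowset n d) (\<lambda>r. m\<^sup>2 + 2 * m * ip n c r + (ip n c r)\<^sup>2)"
  proof (rule avg_cong)
    fix r assume "r \<in> rowset n d"
    hence "ip n a r = m + ip n c r" using centring(2)[of r a] by (simp add: m_def c_def)
    thus "(ip n a r)\<^sup>2 = m\<^sup>2 + 2 * m * ip n c r + (ip n c r)\<^sup>2" by (simp add: power2_sum)
  qed
  also have "\<dots> = m\<^sup>2 + 2 * m * avg (rowset n d) (ip n c) + avg (rowset n d) (\<lambda>r. (ip n c r)\<^sup>2)"
    by (simp add: avg_add avg_cmult avg_rows_const)
  also have "avg (rowset n d) (\<lambda>r. (ip n c r)\<^sup>2) = row_var * ip n c c"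
    unfolding c_def by (rule second_moment_centred) (rule centring)
  also have "avg (rowset n d) (ip n c) = 0" using centring(1)[of a] by (simp add: avg_ip c_def)
  finally show ?thesis using centring(3)[of a] by (simp add: c_def m_def power_mult_distrib power_divide)
qed

text \<open>The centred part gains \<open>row_var\<close>, which is at least p / 2 because p \<le>
  1/2. For the constant part it suffices that p \<ge> 1 / (2 n), which holds since d \<ge>
  1.\<close>

lemma second_moment_lower: "avg (rowset n d) (\<lambda>r. (ip n a r)\<^sup>2) \<ge> real d / (2 * real n) * ip n a a"
proof -
  define s where "s = (\<Sum>i<n. a i)"
  have rd: "1 \<le> real d" "2 * real d \<le> real n" "2 \<le> real n" using d by linarith+
  have c: "ip n a a - s\<^sup>2 / real n \<ge> 0"
    using centring(3)[of a] ip_self_nonneg unfolding s_def by metis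
  have "real d / (2 * real n) * ip n a a = real d / (2 * real n) * (s\<^sup>2 / real n) + real d / (2 * real n) * (ip n a a - s\<^sup>2 / real n)"
    by (simp add: algebra_simps)
  also have "\<dots> \<le> s\<^sup>2 * (real d / real n)\<^sup>2 + row_var * (ip n a a - s\<^sup>2 / real n)"
  proof (rule add_mono)
    have "real d / (2 * real n) * (s\<^sup>2 / real n) = s\<^sup>2 * (real d / real n) * (1 / (2 * real n))"
      by (simp add: mult_ac)
    also have "\<dots> \<le> s\<^sup>2 * (real d / real n) * (real d / real n)"
      using rd by (intro mult_left_mono) (auto simp: field_simps)
    finally show "real d / (2 * real n) * (s\<^sup>2 / real n) \<le> s\<^sup>2 * (real d / real n)\<^sup>2"
      by (simp add: power2_eq_square)
    show "real d / (2 * real n) * (ip n a a - s\<^sup>2 / real n) \<le> row_var * (ip n a a - s\<^sup>2 / real n)"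
      using row_var_bounds c by (intro mult_right_mono) auto
  qed
  finally show ?thesis unfolding second_moment s_def .
qed

text \<open>The moment comparison that Paley--Zygmund requires, uniform in a. Here 168 = 8 + 160:
  the mean gives 8, and the centred part gives 8 * 5 * 4, the 4 coming from |c|^2 \<le> 2 b /
  p.\<close>

lemma fourth_moment:
  "avg (rowset n d) (\<lambda>r. (ip n a r) ^ 4) \<le> 168 / (real d / real n)\<^sup>2 * (avg (rowset n d) (\<lambda>r. (ip n a r)\<^sup>2))\<^sup>2"
proof -
  define p where "p = real d / real n"
  define m where "m = (\<Sum>i<n. a i) * p"
  define c where "c = (\<lambda>i. a i - (\<Sum>i<n. a i) / real n)"
  define b where "b = avg (rowset n d) (\<lambda>r. (ip n a r)\<^sup>2)"
  have p: "0 < p" "p \<le> 1" unfolding p_def using d by (auto simp: field_simps)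
  have cc: "ip n c c \<ge> 0" by (rule ip_self_nonneg)
  have b: "b = m\<^sup>2 + row_var * ip n c c"
    unfolding b_def second_moment m_def c_def centring(3) p_def by (simp add: power_mult_distrib power_divide)
  have m: "m\<^sup>2 \<le> b" unfolding b using row_var_bounds cc by simp
  have "p / 2 * ip n c c \<le> row_var * ip n c c" using row_var_bounds cc unfolding p_def by (intro mult_right_mono) auto
  also have "\<dots> \<le> b" unfolding b by simp
  finally have c: "ip n c c \<le> 2 * b / p" using p by (simp add: field_simps)
  have "avg (rowset n d) (\<lambda>r. (ip n a r) ^ 4) \<le> avg (rowset n d) (\<lambda>r. 8 * m ^ 4 + 8 * (ip n c r) ^ 4)"
  proof (rule avg_mono)
    fix r assume r: "r \<in> rowset n d"
    define y where "y = ip n c r"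
    have sq: "(u + v)\<^sup>2 \<le> 2 * u\<^sup>2 + 2 * v\<^sup>2" for u v :: real
      using zero_le_power2[of "u - v"] by (simp add: power2_eq_square algebra_simps)
    have "(m + y) ^ 4 = ((m + y)\<^sup>2)\<^sup>2" by (simp add: power_mult[symmetric])
    also have "\<dots> \<le> (2 * m\<^sup>2 + 2 * y\<^sup>2)\<^sup>2" by (intro power_mono sq) simp
    also have "\<dots> \<le> 2 * (2 * m\<^sup>2)\<^sup>2 + 2 * (2 * y\<^sup>2)\<^sup>2" by (rule sq)
    also have "\<dots> = 8 * m ^ 4 + 8 * y ^ 4" by (simp add: power_mult_distrib power_mult[symmetric])
    finally show "(ip n a r) ^ 4 \<le> 8 * m ^ 4 + 8 * (ip n c r) ^ 4"
      using centring(2)[OF r, of a] by (simp add: m_def p_def c_def y_def)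
  qed
  also have "\<dots> = 8 * m ^ 4 + 8 * avg (rowset n d) (\<lambda>r. (ip n c r) ^ 4)"
    by (simp add: avg_add avg_cmult avg_rows_const)
  also have "\<dots> \<le> 8 * m ^ 4 + 8 * (5 * (ip n c c)\<^sup>2)"
    using fourth_moment_centred[of c] centring(1)[of a] by (simp add: c_def)
  also have "\<dots> \<le> 8 * b\<^sup>2 + 8 * (5 * (2 * b / p)\<^sup>2)"
  proof -
    have "m ^ 4 = (m\<^sup>2)\<^sup>2" by (simp add: power_mult[symmetric])
    also have "\<dots> \<le> b\<^sup>2" using m by (intro power_mono) auto
    finally have "m ^ 4 \<le> b\<^sup>2" .
    moreover have "(ip n c c)\<^sup>2 \<le> (2 * b / p)\<^sup>2" using c cc by (intro power_mono) auto
    ultimately show ?thesis by linarith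
  qed
  also have "\<dots> \<le> 8 * (b\<^sup>2 / p\<^sup>2) + 160 * (b\<^sup>2 / p\<^sup>2)"
  proof -
    have "b\<^sup>2 \<le> b\<^sup>2 / p\<^sup>2" using p by (simp add: le_divide_eq mult_left_le power_le_one)
    thus ?thesis by (simp add: power_divide power_mult_distrib)
  qed
  finally show ?thesis unfolding b_def p_def by simp
qed

text \<open>Paley--Zygmund for a sum of squares, applied through u - u^2 / (4 L b) \<le> min u (L b).\<close>

lemma sum_squares_lower_tail:
  assumes J: "finite J" "J \<noteq> {}" and a: "\<And>j. j \<in> J \<Longrightarrow> ip n (a j) (a j) > 0"
  shows "avg (rowset n d) (\<lambda>r. if (\<Sum>j\<in>J. (ip n (a j) r)\<^sup>2) < real d / (8 * real n) * (\<Sum>j\<in>J. ip n (a j) (a j)) then 1 else 0)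
    \<le> 1 - (real d / real n)\<^sup>2 / 336"
proof -
  define p where "p = real d / real n"
  define T where "T = real d / (8 * real n) * (\<Sum>j\<in>J. ip n (a j) (a j))"
  define b where "b = (\<lambda>j. avg (rowset n d) (\<lambda>r. (ip n (a j) r)\<^sup>2))"
  define S where "S = (\<Sum>j\<in>J. b j)"
  \<comment> \<open>Chosen so that the quartic correction below is at most half of
    \<open>b j\<close>: 168 / (4 * 84) = 1/2.\<close>
  define L where "L = 84 / p\<^sup>2"
  define Z where "Z = (\<lambda>r. \<Sum>j\<in>J. (ip n (a j) r)\<^sup>2)"
  have p: "0 < p" unfolding p_def using d by (auto simp: field_simps)
  have L: "L > 0" unfolding L_def using p by simp
  have bl: "p / 2 * ip n (a j) (a j) \<le> b j" for j
    unfolding b_def p_def using second_moment_lower[of "a j"] by simp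
  have b: "b j > 0" if "j \<in> J" for j
    using bl[of j] a[OF that] p by (smt (verit) divide_pos_pos mult_pos_pos)
  have S: "S > 0" unfolding S_def using b J by (intro sum_pos) auto
  have "T = (\<Sum>j\<in>J. p / 2 * ip n (a j) (a j)) / 4" by (simp add: T_def p_def sum_distrib_left sum_divide_distrib mult_ac)
  also have "\<dots> \<le> S / 4" unfolding S_def using bl by (intro divide_right_mono sum_mono) auto
  finally have T: "T \<le> S / 4" .
  \<comment> \<open>Each term is truncated separately and keeps half of its mean, so correlations
    between the forms never enter.\<close>
  have "S / 2 \<le> avg (rowset n d) (\<lambda>r. \<Sum>j\<in>J. (ip n (a j) r)\<^sup>2 - (1 / (4 * L * b j)) * (ip n (a j) r) ^ 4)"
  proof -
    have "S / 2 = (\<Sum>j\<in>J. b j / 2)" by (simp add: S_def sum_divide_distrib)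
    also have "\<dots> \<le> (\<Sum>j\<in>J. b j - (1 / (4 * L * b j)) * avg (rowset n d) (\<lambda>r. (ip n (a j) r) ^ 4))"
    proof (rule sum_mono)
      fix j assume j: "j \<in> J"
      have "(1 / (4 * L * b j)) * avg (rowset n d) (\<lambda>r. (ip n (a j) r) ^ 4) \<le> (1 / (4 * L * b j)) * (168 / p\<^sup>2 * (b j)\<^sup>2)"
        using fourth_moment[of "a j"] b[OF j] L unfolding b_def p_def by (intro mult_left_mono) auto
      also have "\<dots> = b j / 2" using b[OF j] p by (simp add: L_def power2_eq_square)
      finally show "b j / 2 \<le> b j - (1 / (4 * L * b j)) * avg (rowset n d) (\<lambda>r. (ip n (a j) r) ^ 4)" by simp
    qed
    also have "\<dots> = avg (rowset n d) (\<lambda>r. \<Sum>j\<in>J. (ip n (a j) r)\<^sup>2 - (1 / (4 * L * b j)) * (ip n (a j) r) ^ 4)"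
      unfolding avg_sum avg_diff avg_cmult b_def ..
    finally show ?thesis .
  qed
  \<comment> \<open>On the event Z < T the truncated sum is below S / 4, elsewhere at most L S.
    Comparison with the mean S / 2 bounds the probability of the event by 1 - 1 / (4 L).\<close>
  also have "\<dots> \<le> avg (rowset n d) (\<lambda>r. L * S + S / 4 - L * S * (if Z r < T then 1 else 0))"
  proof (rule avg_mono)
    fix r assume r: "r \<in> rowset n d"
    show "(\<Sum>j\<in>J. (ip n (a j) r)\<^sup>2 - (1 / (4 * L * b j)) * (ip n (a j) r) ^ 4)
        \<le> L * S + S / 4 - L * S * (if Z r < T then 1 else 0)"
    proof (cases "Z r < T")
      case True
      have "(\<Sum>j\<in>J. (ip n (a j) r)\<^sup>2 - (1 / (4 * L * b j)) * (ip n (a j) r) ^ 4) \<le> Z r"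
        unfolding Z_def using b L by (intro sum_mono) (simp add: less_imp_le)
      thus ?thesis using True T by simp
    next
      case False
      have "(\<Sum>j\<in>J. (ip n (a j) r)\<^sup>2 - (1 / (4 * L * b j)) * (ip n (a j) r) ^ 4) \<le> (\<Sum>j\<in>J. L * b j)"
      proof (rule sum_mono)
        fix j assume j: "j \<in> J"
        define u where "u = (ip n (a j) r)\<^sup>2"
        define h where "h = L * b j"
        have h: "h > 0" unfolding h_def using b[OF j] L by simp
        have "u - u\<^sup>2 / (4 * h) \<le> h"
          using h zero_le_power2[of "u - 2 * h"] by (simp add: field_simps power2_eq_square)
        moreover have "(ip n (a j) r) ^ 4 = u\<^sup>2" by (simp add: u_def power_mult[symmetric])
        hence "(1 / (4 * L * b j)) * (ip n (a j) r) ^ 4 = u\<^sup>2 / (4 * h)"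
          by (simp only: h_def mult.assoc times_divide_eq_left mult_1)
        ultimately show "(ip n (a j) r)\<^sup>2 - (1 / (4 * L * b j)) * (ip n (a j) r) ^ 4 \<le> L * b j"
          unfolding u_def[symmetric] h_def[symmetric] by simp
      qed
      also have "\<dots> = L * S" by (simp add: S_def sum_distrib_left)
      finally show ?thesis using False S by simp
    qed
  qed
  also have "\<dots> = L * S + S / 4 - L * S * avg (rowset n d) (\<lambda>r. if Z r < T then 1 else 0)"
    unfolding avg_diff avg_cmult avg_rows_const ..
  finally have "L * avg (rowset n d) (\<lambda>r. if Z r < T then 1 else 0) * S \<le> (L - 1 / 4) * S"
    by (simp add: algebra_simps)
  hence "L * avg (rowset n d) (\<lambda>r. if Z r < T then 1 else 0) \<le> L - 1 / 4" using S by simp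
  hence "avg (rowset n d) (\<lambda>r. if Z r < T then 1 else 0) \<le> 1 - 1 / (4 * L)" using L by (simp add: field_simps)
  also have "1 / (4 * L) = p\<^sup>2 / 336" unfolding L_def using p by (simp add: field_simps)
  finally show ?thesis unfolding Z_def T_def p_def .
qed

text \<open>The mean square is the trace of the second moment matrix compressed to the orthogonal
  complement. The covariance gives at most the codimension, as \<open>row_var\<close> \<le> 1; the
  mean vector gives the term with the all-ones vector.\<close>

lemma avg_residual:
  assumes "finite J" "indep n J v" "card J \<le> n"
  shows "avg (rowset n d) (\<lambda>r. ip n (residual n J v r) (residual n J v r)) \<le>
    real n - real (card J) + (real d / real n)\<^sup>2 * ip n (residual n J v (\<lambda>_. 1)) (residual n J v (\<lambda>_. 1))"
proof -
  obtain q where q: "onb n J v q" and r: "\<And>x. residual n J v x = (\<lambda>i. x i - (\<Sum>l\<in>J. ip n x (q l) * q l i))"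
    by (rule residual_onb[OF assms(1,2)]) (rule that)
  note nr = norm_residual[OF assms(1) q r]
  define p where "p = real d / real n"
  define s where "s = (\<lambda>l. \<Sum>i<n. q l i)"
  define Q where "Q = (\<Sum>l\<in>J. (s l)\<^sup>2)"
  have rd: "1 \<le> real d" "2 * real d \<le> real n" "2 \<le> real n" using d by linarith+
  have one: "ip n (residual n J v (\<lambda>_. 1)) (residual n J v (\<lambda>_. 1)) = real n - Q"
    unfolding nr by (simp add: Q_def s_def ip_def)
  hence Qn: "Q \<le> real n" using ip_self_nonneg[of n "residual n J v (\<lambda>_. 1)"] by simp
  have "avg (rowset n d) (\<lambda>r. ip n (residual n J v r) (residual n J v r)) =
     avg (rowset n d) (\<lambda>r. real d - (\<Sum>l\<in>J. (ip n (q l) r)\<^sup>2))"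
  proof (rule avg_cong)
    fix r assume r: "r \<in> rowset n d"
    have "r i * r i = r i" for i
    proof -
      have "r i = 0 \<or> r i = 1" using r by (auto simp: rowset_def)
      thus ?thesis by auto
    qed
    hence "ip n r r = (\<Sum>i<n. r i)" unfolding ip_def by (rule sum.cong[OF refl])
    hence "ip n r r = real d" using r by (simp add: rowset_def)
    thus "ip n (residual n J v r) (residual n J v r) = real d - (\<Sum>l\<in>J. (ip n (q l) r)\<^sup>2)"
      unfolding nr by (metis (no_types, lifting) ip_commute sum.cong)
  qed
  also have "\<dots> = real d - (\<Sum>l\<in>J. (s l)\<^sup>2 * p\<^sup>2 + row_var * (ip n (q l) (q l) - (s l)\<^sup>2 / real n))"
    unfolding avg_diff avg_rows_const avg_sum second_moment s_def p_def ..
  also have "(\<Sum>l\<in>J. (s l)\<^sup>2 * p\<^sup>2 + row_var * (ip n (q l) (q l) - (s l)\<^sup>2 / real n)) =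
      (\<Sum>l\<in>J. (s l)\<^sup>2 * p\<^sup>2 + row_var - (row_var / real n) * (s l)\<^sup>2)"
    using q by (intro sum.cong) (auto simp: onb_def algebra_simps)
  also have "\<dots> = Q * p\<^sup>2 + row_var * real (card J) - row_var / real n * Q"
    unfolding sum.distrib sum_subtractf sum_distrib_right[symmetric] sum_distrib_left[symmetric] Q_def by simp
  also have "real d - (Q * p\<^sup>2 + row_var * real (card J) - row_var / real n * Q)
     = p\<^sup>2 * (real n - Q) + row_var * (real n - real (card J)) - row_var * (1 - Q / real n)"
  proof -
    \<comment> \<open>The full trace: |r|^2 = d is the squared mean p^2 n plus the variance in n - 1
      centred directions.\<close>
    have "real d = p\<^sup>2 * real n + row_var * (real n - 1)"
      using rd by (simp add: row_var_def p_def power2_eq_square field_simps)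
    thus ?thesis by (simp add: algebra_simps)
  qed
  also have "\<dots> \<le> p\<^sup>2 * (real n - Q) + 1 * (real n - real (card J)) - 0"
    using row_var_bounds assms(3) Qn rd by (intro diff_mono add_mono mult_right_mono mult_nonneg_nonneg) (auto simp: field_simps)
  finally show ?thesis unfolding one p_def by simp
qed

end

subsection \<open>Independent rows\<close>

context
  fixes n d :: nat
  assumes d: "0 < d" "2 * d \<le> n"
begin

lemma finite_Mnd: "finite (Mnd n d)"
  unfolding Mnd_eq by (intro finite_PiE_dflt finite_rowset) auto

lemma Mnd_row: "M \<in> Mnd n d \<Longrightarrow> i < n \<Longrightarrow> M i \<in> rowset n d"
  by (simp add: Mnd_eq PiE_dflt_def)

lemma Mnd_update: "M \<in> Mnd n d \<Longrightarrow> i < n \<Longrightarrow> r \<in> rowset n d \<Longrightarrow> M(i := r) \<in> Mnd n d"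
  by (auto simp: Mnd_eq PiE_dflt_def)

lemma Mnd_nonempty: "Mnd n d \<noteq> {}"
proof -
  obtain r where "r \<in> rowset n d" using rowset_nonempty[of d n] d by auto
  hence "(\<lambda>i. if i < n then r else (\<lambda>_. 0)) \<in> Mnd n d" by (auto simp: Mnd_eq PiE_dflt_def)
  thus ?thesis by blast
qed

lemma avg_Mnd_const: "avg (Mnd n d) (\<lambda>_. c) = c"
  by (intro avg_const finite_Mnd Mnd_nonempty)

text \<open>Because (M, r) \<mapsto> (M(i := r), M i) is an involution.\<close>

lemma avg_resample:
  assumes i: "i < n"
  shows "avg (Mnd n d) F = avg (Mnd n d) (\<lambda>M. avg (rowset n d) (\<lambda>r. F (M(i := r))))"
proof -
  have R: "real (card (rowset n d)) > 0"
    using finite_rowset[of n d] rowset_nonempty[of d n] d by (simp add: card_gt_0_iff)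
  have "(\<Sum>M\<in>Mnd n d. \<Sum>r\<in>rowset n d. F (M(i := r))) =
      (\<Sum>x\<in>Mnd n d \<times> rowset n d. F ((fst x)(i := snd x)))"
    by (simp add: sum.cartesian_product case_prod_beta)
  also have "\<dots> = (\<Sum>x\<in>Mnd n d \<times> rowset n d. F (fst x))"
    by (rule sum.reindex_bij_witness[of _ "\<lambda>x. ((fst x)(i := snd x), fst x i)" "\<lambda>x. ((fst x)(i := snd x), fst x i)"])
       (use i in \<open>auto simp: Mnd_row Mnd_update\<close>)
  also have "\<dots> = (\<Sum>M\<in>Mnd n d. \<Sum>r\<in>rowset n d. F M)"
    unfolding sum.cartesian_product by (simp add: case_prod_beta)
  also have "\<dots> = real (card (rowset n d)) * (\<Sum>M\<in>Mnd n d. F M)" by (simp add: sum_distrib_left)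
  finally have "(\<Sum>M\<in>Mnd n d. F M) = (\<Sum>M\<in>Mnd n d. \<Sum>r\<in>rowset n d. F (M(i := r))) / real (card (rowset n d))"
    using R by (simp add: field_simps)
  thus ?thesis by (simp add: avg_def sum_divide_distrib)
qed

text \<open>Entries of one column are independent with mean p. Resampling row a kills the cross
  term, so the variances p (1 - p) \<le> p add up.\<close>

lemma avg_column_deviation:
  assumes "finite J" "J \<subseteq> {..<n}" "c < n"
  shows "avg (Mnd n d) (\<lambda>M. (\<Sum>j\<in>J. M j c - real d / real n)\<^sup>2) \<le> real (card J) * (real d / real n)"
  using assms
proof (induction J rule: finite_induct)
  case empty
  show ?case by (simp add: avg_Mnd_const)
next
  case (insert a J)
  define p where "p = real d / real n"
  define Y where "Y = (\<lambda>M :: nat \<Rightarrow> nat \<Rightarrow> real. \<Sum>j\<in>J. M j c - p)"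
  have a: "a < n" using insert by auto
  have p: "avg (rowset n d) (\<lambda>r. r c) = p" unfolding p_def by (rule avg_entry[OF d \<open>c < n\<close>])
  have Y: "Y (M(a := r)) = Y M" for M r unfolding Y_def using insert.hyps by (intro sum.cong) auto
  have rs: "(\<Sum>j\<in>insert a J. M j c - p)\<^sup>2 = (M a c - p)\<^sup>2 + 2 * (Y M * (M a c - p)) + (Y M)\<^sup>2" for M
    using insert.hyps by (simp add: Y_def power2_sum)
  have "avg (Mnd n d) (\<lambda>M. (M a c - p)\<^sup>2) = avg (Mnd n d) (\<lambda>M. avg (rowset n d) (\<lambda>r. (r c - p)\<^sup>2))"
    by (subst avg_resample[OF a]) simp
  also have "\<dots> = avg (rowset n d) (\<lambda>r. (r c - p)\<^sup>2)" by (rule avg_Mnd_const)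
  also have "\<dots> = avg (rowset n d) (\<lambda>r. (1 - 2 * p) * r c + p\<^sup>2)"
  proof (rule avg_cong)
    fix r assume "r \<in> rowset n d"
    hence "r c = 0 \<or> r c = 1" by (auto simp: rowset_def)
    thus "(r c - p)\<^sup>2 = (1 - 2 * p) * r c + p\<^sup>2" by (auto simp: power2_eq_square algebra_simps)
  qed
  also have "\<dots> = (1 - 2 * p) * p + p\<^sup>2" unfolding avg_add avg_cmult p avg_rows_const[OF d] ..
  also have "\<dots> \<le> p" by (simp add: power2_eq_square algebra_simps)
  finally have 1: "avg (Mnd n d) (\<lambda>M. (M a c - p)\<^sup>2) \<le> p" .
  have "avg (Mnd n d) (\<lambda>M. Y M * (M a c - p)) = avg (Mnd n d) (\<lambda>M. avg (rowset n d) (\<lambda>r. Y M * (r c - p)))"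
    by (subst avg_resample[OF a]) (simp add: Y)
  also have "\<dots> = 0" unfolding avg_cmult avg_diff p avg_rows_const[OF d] by (simp add: avg_Mnd_const)
  finally have 2: "avg (Mnd n d) (\<lambda>M. Y M * (M a c - p)) = 0" .
  have 3: "avg (Mnd n d) (\<lambda>M. (Y M)\<^sup>2) \<le> real (card J) * p"
    unfolding Y_def p_def by (rule insert.IH) (use insert.prems in auto)
  show ?case unfolding p_def[symmetric] rs avg_add avg_cmult 2
    using 1 3 insert.hyps by (simp add: algebra_simps)
qed

text \<open>The sum of the rows in J divided by m p lies in the span; each coordinate has mean 1 and
  variance at most 1 / (m p). For m of order n the all-ones vector is thus within a bounded mean
  square distance of the span.\<close>

lemma avg_residual_one:
  assumes J: "J \<subseteq> {..<n}" "0 < card J"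
  shows "avg (Mnd n d) (\<lambda>M. if indep n J M then ip n (residual n J M (\<lambda>_. 1)) (residual n J M (\<lambda>_. 1)) else 0)
    \<le> real n / (real (card J) * (real d / real n))"
proof -
  define p where "p = real d / real n"
  define m where "m = real (card J)"
  have fJ: "finite J" using J finite_subset by blast
  have p: "p > 0" and m: "m > 0" and n: "n > 0" unfolding p_def m_def using d J by auto
  have "avg (Mnd n d) (\<lambda>M. if indep n J M then ip n (residual n J M (\<lambda>_. 1)) (residual n J M (\<lambda>_. 1)) else 0)
    \<le> avg (Mnd n d) (\<lambda>M. \<Sum>c<n. (1 / (m * p))\<^sup>2 * (\<Sum>j\<in>J. M j c - p)\<^sup>2)"
  proof (rule avg_mono)
    fix M :: "nat \<Rightarrow> nat \<Rightarrow> real"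
    define y where "y = (\<lambda>i. \<Sum>j\<in>J. (1 / (m * p)) * M j i)"
    show "(if indep n J M then ip n (residual n J M (\<lambda>_. 1)) (residual n J M (\<lambda>_. 1)) else 0)
      \<le> (\<Sum>c<n. (1 / (m * p))\<^sup>2 * (\<Sum>j\<in>J. M j c - p)\<^sup>2)"
    proof (cases "indep n J M")
      case False
      thus ?thesis by (simp add: sum_nonneg)
    next
      case True
      have "lspan n J M y" unfolding y_def using fJ by (intro lspan_sum lspan_mem)
      from residual_minimal[OF fJ True this, of "\<lambda>_. 1"]
      have "ip n (residual n J M (\<lambda>_. 1)) (residual n J M (\<lambda>_. 1)) \<le> ip n (\<lambda>i. 1 - y i) (\<lambda>i. 1 - y i)" .
      also have "\<dots> = (\<Sum>c<n. (1 / (m * p))\<^sup>2 * (\<Sum>j\<in>J. M j c - p)\<^sup>2)"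
        unfolding ip_def
      proof (intro sum.cong refl)
        fix c
        define s where "s = (\<Sum>j\<in>J. M j c)"
        have y: "y c = (1 / (m * p)) * s" by (simp add: y_def s_def sum_divide_distrib)
        have e: "(\<Sum>j\<in>J. M j c - p) = s - m * p" by (simp add: sum_subtractf s_def m_def)
        show "(1 - y c) * (1 - y c) = (1 / (m * p))\<^sup>2 * (\<Sum>j\<in>J. M j c - p)\<^sup>2"
          unfolding y e using p m by (simp add: power2_eq_square field_simps)
      qed
      finally show ?thesis using True by simp
    qed
  qed
  also have "\<dots> = (\<Sum>c<n. (1 / (m * p))\<^sup>2 * avg (Mnd n d) (\<lambda>M. (\<Sum>j\<in>J. M j c - p)\<^sup>2))"
    unfolding avg_sum avg_cmult ..
  also have "\<dots> \<le> (\<Sum>c<n. (1 / (m * p))\<^sup>2 * (m * p))"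
    using avg_column_deviation[OF fJ J(1)] unfolding m_def p_def
    by (intro sum_mono mult_left_mono) auto
  also have "\<dots> = real n / (m * p)" using m p by (simp add: power2_eq_square)
  finally show ?thesis unfolding m_def p_def .
qed

text \<open>Row i is independent of J, so it can be resampled with the residual map fixed. The
  summand 1 bounds the contribution of the mean, p n / card J, via p \<le> 1/2 and n \<le> 2 card J.
  Dependent families are assigned the value 0.\<close>

lemma avg_dist_row:
  assumes J: "J \<subseteq> {..<n}" "n \<le> 2 * card J" and i: "i < n" "i \<notin> J"
  shows "avg (Mnd n d) (\<lambda>M. if indep n J M then ip n (residual n J M (M i)) (residual n J M (M i)) else 0)
    \<le> real n - real (card J) + 1"
proof -
  define p where "p = real d / real n"
  define D where "D = (\<lambda>M. if indep n J M then ip n (residual n J M (\<lambda>_. 1)) (residual n J M (\<lambda>_. 1)) else 0)"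
  have fJ: "finite J" using J finite_subset by blast
  have cJ: "card J \<le> n" using card_mono[of "{..<n}" J] J by simp
  have p: "p > 0" "p \<le> 1/2" and n: "n > 0" unfolding p_def using d by (auto simp: field_simps)
  have m: "card J > 0" using J n by simp
  have res: "residual n J (M(i := r)) = residual n J M" and ind: "indep n J (M(i := r)) = indep n J M" for M r
    using i by (auto intro!: residual_cong)
  have "avg (Mnd n d) (\<lambda>M. if indep n J M then ip n (residual n J M (M i)) (residual n J M (M i)) else 0)
    = avg (Mnd n d) (\<lambda>M. avg (rowset n d) (\<lambda>r. if indep n J M then ip n (residual n J M r) (residual n J M r) else 0))"
    by (subst avg_resample[OF i(1)]) (simp add: res ind cong: if_cong)
  also have "\<dots> \<le> avg (Mnd n d) (\<lambda>M. (real n - real (card J)) + p\<^sup>2 * D M)"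
  proof (rule avg_mono)
    fix M :: "nat \<Rightarrow> nat \<Rightarrow> real"
    show "avg (rowset n d) (\<lambda>r. if indep n J M then ip n (residual n J M r) (residual n J M r) else 0)
      \<le> (real n - real (card J)) + p\<^sup>2 * D M"
      using avg_residual[OF d fJ _ cJ, of M] cJ by (simp add: D_def p_def avg_rows_const[OF d])
  qed
  also have "\<dots> = (real n - real (card J)) + p\<^sup>2 * avg (Mnd n d) D"
    unfolding avg_add avg_cmult avg_Mnd_const ..
  also have "\<dots> \<le> (real n - real (card J)) + p\<^sup>2 * (real n / (real (card J) * p))"
    using avg_residual_one[OF J(1) m] unfolding D_def p_def by (intro add_left_mono mult_left_mono) auto
  also have "p\<^sup>2 * (real n / (real (card J) * p)) = p * (real n / real (card J))"
    using p by (simp add: power2_eq_square)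
  also have "\<dots> \<le> 1 / 2 * 2"
  proof (rule mult_mono)
    have "real n \<le> 2 * real (card J)" using J(2) by (metis of_nat_le_iff of_nat_mult of_nat_numeral)
    thus "real n / real (card J) \<le> 2" using m by (simp add: field_simps)
  qed (use p in auto)
  finally show ?thesis by simp
qed

text \<open>\<open>Q M\<close> is unaffected by the first k rows; given the others these rows are
  independent, and resampling row m splits off one factor c.\<close>

lemma avg_all_rows:
  assumes Q: "\<And>M i r. i < k \<Longrightarrow> Q (M(i := r)) = Q M"
    and le: "\<And>M. avg (rowset n d) (\<lambda>r. if Q M r then 1 else 0) \<le> c"
    and "k \<le> n" "0 \<le> c"
  shows "avg (Mnd n d) (\<lambda>M. if \<forall>i<k. Q M (M i) then 1 else 0) \<le> c ^ k"
proof -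
  have "avg (Mnd n d) (\<lambda>M. if \<forall>i<m. Q M (M i) then 1 else 0) \<le> c ^ m" if "m \<le> k" for m
    using that
  proof (induction m)
    case 0
    show ?case by (simp add: avg_Mnd_const)
  next
    case (Suc m)
    define I where "I = (\<lambda>M. if \<forall>i<m. Q M (M i) then 1 else 0 :: real)"
    have m: "m < n" "m < k" using Suc \<open>k \<le> n\<close> by auto
    have "(if \<forall>i<Suc m. Q M (M i) then 1 else 0) = I M * (if Q M (M m) then 1 else 0)" for M
      by (auto simp: I_def less_Suc_eq)
    hence "avg (Mnd n d) (\<lambda>M. if \<forall>i<Suc m. Q M (M i) then 1 else 0) =
        avg (Mnd n d) (\<lambda>M. I M * (if Q M (M m) then 1 else 0))" by simp
    also have "\<dots> = avg (Mnd n d) (\<lambda>M. avg (rowset n d) (\<lambda>r. I M * (if Q M r then 1 else 0)))"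
      by (subst avg_resample[OF m(1)]) (simp add: I_def Q[OF m(2)] cong: if_cong)
    also have "\<dots> \<le> avg (Mnd n d) (\<lambda>M. c * I M)"
    proof (rule avg_mono)
      fix M
      show "avg (rowset n d) (\<lambda>r. I M * (if Q M r then 1 else 0)) \<le> c * I M"
        unfolding avg_cmult mult.commute[of c] using le[of M] by (intro mult_left_mono) (auto simp: I_def)
    qed
    also have "\<dots> \<le> c * c ^ m" unfolding avg_cmult using Suc \<open>0 \<le> c\<close> by (intro mult_left_mono) (auto simp: I_def)
    finally show ?case by simp
  qed
  thus ?thesis by blast
qed

lemma avg_Markov:
  assumes "\<And>M. M \<in> Mnd n d \<Longrightarrow> 0 \<le> F M" "avg (Mnd n d) F \<le> t" "0 < t" "0 < \<epsilon>"
  shows "avg (Mnd n d) (\<lambda>M. if F M > t / \<epsilon> then 1 else 0) \<le> \<epsilon>"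
proof -
  have "avg (Mnd n d) (\<lambda>M. if F M > t / \<epsilon> then 1 else 0) \<le> avg (Mnd n d) (\<lambda>M. (\<epsilon> / t) * F M)"
    by (rule avg_mono) (use assms in \<open>auto simp: field_simps\<close>)
  also have "\<dots> \<le> (\<epsilon> / t) * t" unfolding avg_cmult using assms by (intro mult_left_mono) auto
  finally show ?thesis using assms by simp
qed

end

section \<open>Coefficients of a row along the rows with index at least k\<close>

text \<open>The vectors dual n k M j, k \<le> j < n, are the basis of the span of the rows with index at least k
  dual to these rows.\<close>

definition normal :: "nat \<Rightarrow> nat \<Rightarrow> (nat \<Rightarrow> nat \<Rightarrow> real) \<Rightarrow> nat \<Rightarrow> nat \<Rightarrow> real" where
  "normal n k M j = residual n ({k..<n} - {j}) M (M j)"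

definition dual :: "nat \<Rightarrow> nat \<Rightarrow> (nat \<Rightarrow> nat \<Rightarrow> real) \<Rightarrow> nat \<Rightarrow> nat \<Rightarrow> real" where
  "dual n k M j = (\<lambda>i. (1 / ip n (normal n k M j) (normal n k M j)) * normal n k M j i)"

lemma normal_pos:
  assumes "indep n {k..<n} M" "j \<in> {k..<n}"
  shows "ip n (normal n k M j) (normal n k M j) > 0"
  unfolding normal_def using assms by (intro residual_pos) (auto simp: insert_absorb)

lemma ip_dual_self:
  "ip n (dual n k M j) (dual n k M j) = 1 / ip n (normal n k M j) (normal n k M j)"
proof -
  define w where "w = normal n k M j"
  have "ip n (\<lambda>i. c * w i) (\<lambda>i. c * w i) = c * c * ip n w w" for c
    by (simp add: ip_def sum_distrib_left mult_ac)
  thus ?thesis unfolding dual_def w_def[symmetric] by (simp only:) simp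
qed

lemma smin_le_residual:
  assumes ind: "indep n {..<n} M" and i: "i < k" "k \<le> n" and s: "s \<ge> 0"
    and le: "ip n (residual n {k..<n} M (M i)) (residual n {k..<n} M (M i)) \<le>
      s\<^sup>2 * (\<Sum>j\<in>{k..<n}. (ip n (dual n k M j) (M i))\<^sup>2)"
  shows "smin n M \<le> s"
proof -
  define K where "K = {k..<n}"
  define x where "x = residual n K M (M i)"
  have fK: "finite K" and K: "K \<subseteq> {..<n}" and iK: "i \<notin> K" unfolding K_def using i by auto
  have iK': "indep n K M" by (rule indep_mono[OF _ K ind]) simp
  have iKj: "indep n (K - {j}) M" for j by (rule indep_mono[OF _ _ iK']) (use fK in auto)
  obtain c where c: "\<forall>a<n. M i a - x a = (\<Sum>l\<in>K. c l * M l a)"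
    using lspan_residual[OF fK iK', of "M i"] unfolding lspan_def x_def by blast
  have cj: "c j = ip n (dual n k M j) (M i)" if j: "j \<in> K" for j
  proof -
    define w where "w = normal n k M j"
    have w: "w = residual n (K - {j}) M (M j)" by (simp add: w_def normal_def K_def)
    have wpos: "ip n w w > 0" unfolding w_def using iK' j by (intro normal_pos) (auto simp: K_def)
    have wl: "ip n w (M l) = 0" if "l \<in> K - {j}" for l
      unfolding w using iKj that fK by (intro residual_orthogonal) auto
    have sp: "lspan n (K - {j}) M (\<lambda>a. M j a - w a)"
      unfolding w using iKj fK by (intro lspan_residual) auto
    have wj: "ip n w (M j) = ip n w w"
      using lspan_orthogonal[OF sp wl] by (simp add: ip_diff_right)
    \<comment> \<open>This vector is w, so w lies in the span and is orthogonal to x. Pairing the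
      expansion of \<open>M i\<close> with w then isolates \<open>c j\<close>.\<close>
    have "lspan n K M (\<lambda>a. M j a - 1 * (M j a - w a))"
      using fK j by (intro lspan_diff lspan_mem lspan_mono[OF fK _ sp]) auto
    hence "ip n x w = 0"
      using lspan_orthogonal[of n K M w x] residual_orthogonal[OF fK iK'] by (simp add: x_def)
    hence "ip n w (M i) = ip n w (\<lambda>a. M i a - x a)" by (simp add: ip_diff_right ip_commute[of n w x])
    also have "\<dots> = ip n w (\<lambda>a. \<Sum>l\<in>K. c l * M l a)" using c by (intro ip_cong) auto
    also have "\<dots> = (\<Sum>l\<in>K. if j = l then c l * ip n w w else 0)"
      unfolding ip_sum_right using wl wj by (intro sum.cong) auto
    also have "\<dots> = c j * ip n w w" using fK j by simp
    finally have "ip n (M i) w = c j * ip n w w" by (simp add: ip_commute)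
    moreover have "ip n (M i) (dual n k M j) = (1 / ip n w w) * ip n (M i) w"
      unfolding dual_def w_def by (rule ip_scale_right)
    ultimately have "ip n (M i) (dual n k M j) = c j" using wpos by simp
    thus ?thesis by (metis ip_commute)
  qed
  define y where "y = (\<lambda>l. if l = i then 1 else if l \<in> K then - c l else 0)"
  \<comment> \<open>y vanishes on all rows below k except i. One formula serves both |y|^2 and the
    combination of rows, as each summand is 0 where y is.\<close>
  have sumy: "(\<Sum>l<n. g (y l) l) = g 1 i + (\<Sum>l\<in>K. g (- c l) l)"
    if g: "\<And>l. g 0 l = 0" for g :: "real \<Rightarrow> nat \<Rightarrow> real"
  proof -
    have "(\<Sum>l<n. g (y l) l) = (\<Sum>l\<in>insert i K. g (y l) l)"
      using i K by (intro sum.mono_neutral_right) (auto simp: y_def g)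
    also have "\<dots> = g (y i) i + (\<Sum>l\<in>K. g (y l) l)" using fK iK by simp
    also have "(\<Sum>l\<in>K. g (y l) l) = (\<Sum>l\<in>K. g (- c l) l)"
      using iK by (intro sum.cong) (auto simp: y_def)
    finally show ?thesis by (simp add: y_def)
  qed
  have y2: "(\<Sum>l<n. (y l)\<^sup>2) = 1 + (\<Sum>l\<in>K. (c l)\<^sup>2)" using sumy[of "\<lambda>v l. v\<^sup>2"] by simp
  have yx: "(\<Sum>l<n. y l * M l a) = x a" if "a < n" for a
  proof -
    have "(\<Sum>l<n. y l * M l a) = M i a - (\<Sum>l\<in>K. c l * M l a)"
      using sumy[of "\<lambda>v l. v * M l a"] by (simp add: sum_negf)
    thus ?thesis using c[rule_format, OF that] by linarith
  qed
  have pos: "0 \<le> (\<Sum>l\<in>K. (c l)\<^sup>2)" by (simp add: sum_nonneg)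
  show ?thesis
  proof (rule smin_le_transpose[OF ind s])
    show "(\<Sum>l<n. (y l)\<^sup>2) > 0" using pos y2 by linarith
    have "ip n (\<lambda>a. \<Sum>l<n. y l * M l a) (\<lambda>a. \<Sum>l<n. y l * M l a) = ip n x x"
      using yx by (intro ip_cong) auto
    also have "\<dots> \<le> s\<^sup>2 * (\<Sum>j\<in>K. (ip n (dual n k M j) (M i))\<^sup>2)"
      using le unfolding x_def K_def .
    also have "\<dots> = s\<^sup>2 * (\<Sum>l\<in>K. (c l)\<^sup>2)" using cj by simp
    also have "\<dots> \<le> s\<^sup>2 * (\<Sum>l<n. (y l)\<^sup>2)" unfolding y2 by (intro mult_left_mono) auto
    finally show "ip n (\<lambda>a. \<Sum>l<n. y l * M l a) (\<lambda>a. \<Sum>l<n. y l * M l a) \<le> s\<^sup>2 * (\<Sum>l<n. (y l)\<^sup>2)" .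
  qed
qed

lemma sum_inverse_ge:
  fixes f :: "'a \<Rightarrow> real"
  assumes "finite K" "\<And>j. j \<in> K \<Longrightarrow> f j > 0" "(\<Sum>j\<in>K. f j) \<le> real (card K) * a" "a > 0"
  shows "(\<Sum>j\<in>K. 1 / f j) \<ge> real (card K) / a"
proof -
  define u where "u = real (card K) / a"
  have "2 / a - f j / a\<^sup>2 \<le> 1 / f j" if "j \<in> K" for j
  proof -
    have "0 \<le> (f j - a)\<^sup>2 / (f j * a\<^sup>2)" using assms(2)[OF that] by simp
    also have "\<dots> = 1 / f j - (2 / a - f j / a\<^sup>2)"
      using assms(2)[OF that] assms(4) by (simp add: power2_eq_square field_simps)
    finally show ?thesis by simp
  qed
  hence "(\<Sum>j\<in>K. 2 / a - f j / a\<^sup>2) \<le> (\<Sum>j\<in>K. 1 / f j)" by (rule sum_mono)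
  moreover have "(\<Sum>j\<in>K. 2 / a - f j / a\<^sup>2) = 2 * u - (\<Sum>j\<in>K. f j) / a\<^sup>2"
    by (simp add: sum_subtractf sum_divide_distrib u_def)
  moreover have "(\<Sum>j\<in>K. f j) / a\<^sup>2 \<le> real (card K) * a / a\<^sup>2" using assms by (intro divide_right_mono) auto
  moreover have "real (card K) * a / a\<^sup>2 = u" using assms(4) by (simp add: power2_eq_square u_def)
  ultimately have "u \<le> (\<Sum>j\<in>K. 1 / f j)" by (smt (verit))
  thus ?thesis by (simp add: u_def)
qed

text \<open>Three bad events: residuals too large, distances too large (each \<epsilon> by Markov),
  and all k rows having small coefficients (geometric in k).\<close>

lemma prob_smin_le:
  fixes \<epsilon> :: real
  assumes d: "0 < d" "2 * d \<le> n" and k: "1 \<le> k" "2 * (k + 1) \<le> n" and e: "0 < \<epsilon>"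
    and ke: "96 * real k ^ 3 * \<epsilon>\<^sup>2 \<le> (real d / real n)\<^sup>2"
  shows "measure_pmf.prob (pmf_of_set (Mnd n d)) {M. smin n M \<le> sqrt (real d) / (\<epsilon>\<^sup>2 * real n)}
    \<ge> 1 - 2 * \<epsilon> - (1 - (real d / real n)\<^sup>2 / 336) ^ k"
proof -
  define p where "p = real d / real n"
  define K where "K = {k..<n}"
  define s where "s = sqrt (real d) / (\<epsilon>\<^sup>2 * real n)"
  define c where "c = 1 - p\<^sup>2 / 336"
  define x where "x = (\<lambda>M i. ip n (residual n K M (M i)) (residual n K M (M i)))"
  define w where "w = (\<lambda>M j. ip n (normal n k M j) (normal n k M j))"
  \<comment> \<open>Summed over i because the row chosen in the end depends on M.\<close>
  define X where "X = (\<lambda>M. \<Sum>i<k. if indep n K M then x M i else 0)"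
  define W where "W = (\<lambda>M. \<Sum>j\<in>K. if indep n (K - {j}) M then w M j else 0)"
  define Q where "Q = (\<lambda>M r. indep n K M \<and>
      (\<Sum>j\<in>K. (ip n (dual n k M j) r)\<^sup>2) < real d / (8 * real n) * (\<Sum>j\<in>K. ip n (dual n k M j) (dual n k M j)))"
  define B where "B = (\<lambda>M. \<forall>i<k. Q M (M i))"
  have fK: "finite K" "K \<subseteq> {..<n}" and cK: "card K = n - k" unfolding K_def by auto
  have p: "0 < p" "p \<le> 1/2" and n: "n > 0" unfolding p_def using d by (auto simp: field_simps)
  have c: "0 \<le> c"
  proof -
    have "p\<^sup>2 \<le> (1/2)\<^sup>2" using p by (intro power_mono) auto
    thus ?thesis by (simp add: c_def power2_eq_square)
  qed

  have "avg (Mnd n d) X \<le> (\<Sum>i<k. real k + 1)"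
    unfolding X_def avg_sum
  proof (rule sum_mono)
    fix i assume "i \<in> {..<k}"
    hence "avg (Mnd n d) (\<lambda>M. if indep n K M then x M i else 0) \<le> real n - real (card K) + 1"
      unfolding x_def using fK k by (intro avg_dist_row[OF d]) (auto simp: K_def)
    thus "avg (Mnd n d) (\<lambda>M. if indep n K M then x M i else 0) \<le> real k + 1" using k by (simp add: cK)
  qed
  hence "avg (Mnd n d) (\<lambda>M. if X M > real k * (real k + 1) / \<epsilon> then 1 else 0) \<le> \<epsilon>"
    using k e by (intro avg_Markov[OF d]) (auto simp: X_def x_def ip_self_nonneg intro!: sum_nonneg)
  note PX = this

  have "avg (Mnd n d) W \<le> (\<Sum>j\<in>K. real k + 2)"
    unfolding W_def avg_sum
  proof (rule sum_mono)
    fix j assume j: "j \<in> K"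
    \<comment> \<open>Removing j raises the codimension to k + 1, hence k + 2 below. That at least
      half of the rows remain is the assumption 2 (k + 1) \<le> n.\<close>
    hence card: "card (K - {j}) = n - k - 1" using fK by (simp add: cK)
    have "avg (Mnd n d) (\<lambda>M. if indep n (K - {j}) M then w M j else 0) \<le> real n - real (card (K - {j})) + 1"
      unfolding w_def normal_def K_def[symmetric]
      using fK k j card by (intro avg_dist_row[OF d]) (auto simp: K_def)
    thus "avg (Mnd n d) (\<lambda>M. if indep n (K - {j}) M then w M j else 0) \<le> real k + 2"
      using k by (simp add: card)
  qed
  hence "avg (Mnd n d) (\<lambda>M. if W M > (real n - real k) * (real k + 2) / \<epsilon> then 1 else 0) \<le> \<epsilon>"
    using k e by (intro avg_Markov[OF d]) (auto simp: W_def w_def ip_self_nonneg cK intro!: sum_nonneg)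
  note PW = this

  have "avg (Mnd n d) (\<lambda>M. if B M then 1 else 0) \<le> c ^ k"
    unfolding B_def
  proof (rule avg_all_rows[OF d])
    fix M :: "nat \<Rightarrow> nat \<Rightarrow> real" and i r assume "i < k"
    hence "\<And>l. l \<in> K \<Longrightarrow> (M(i := r)) l = M l" by (auto simp: K_def)
    hence "indep n K (M(i := r)) = indep n K M" "\<And>j. j \<in> K \<Longrightarrow> dual n k (M(i := r)) j = dual n k M j"
      using residual_cong[of "K - {_}" "M(i := r)" M n] residual_cong(2)[of K "M(i := r)" M n]
      by (auto simp: dual_def normal_def K_def[symmetric])
    thus "Q (M(i := r)) = Q M" by (intro ext) (simp add: Q_def)
  next
    fix M :: "nat \<Rightarrow> nat \<Rightarrow> real"
    show "avg (rowset n d) (\<lambda>r. if Q M r then 1 else 0) \<le> c"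
    proof (cases "indep n K M")
      case False
      thus ?thesis using c by (simp add: Q_def avg_rows_const[OF d])
    next
      case True
      have "ip n (dual n k M j) (dual n k M j) > 0" if "j \<in> K" for j
        unfolding ip_dual_self using normal_pos[of n k M j] True that by (simp add: K_def)
      moreover have "K \<noteq> {}" using k by (auto simp: K_def)
      ultimately have "avg (rowset n d) (\<lambda>r. if (\<Sum>j\<in>K. (ip n (dual n k M j) r)\<^sup>2) <
          real d / (8 * real n) * (\<Sum>j\<in>K. ip n (dual n k M j) (dual n k M j)) then 1 else 0) \<le> c"
        unfolding c_def p_def using fK by (intro sum_squares_lower_tail[OF d]) auto
      thus ?thesis using True by (simp add: Q_def)
    qed
  qed (use k c in auto)
  note PB = this

  have good: "smin n M \<le> s"
    if MX: "X M \<le> real k * (real k + 1) / \<epsilon>" and MW: "W M \<le> (real n - real k) * (real k + 2) / \<epsilon>"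
      and MB: "\<not> B M" for M
  proof (cases "indep n {..<n} M")
    case False
    thus ?thesis using smin_dependent_rows[OF False] unfolding s_def
      by (smt (verit) divide_nonneg_nonneg mult_nonneg_nonneg of_nat_0_le_iff real_sqrt_ge_zero zero_le_power2)
  next
    case True
    have iK: "indep n K M" by (rule indep_mono[OF _ fK(2) True]) simp
    have iKj: "indep n (K - {j}) M" for j by (rule indep_mono[OF _ _ iK]) (use fK in auto)
    obtain i where i: "i < k" "(\<Sum>j\<in>K. (ip n (dual n k M j) (M i))\<^sup>2) \<ge> p / 8 * (\<Sum>j\<in>K. 1 / w M j)"
      using MB iK unfolding B_def Q_def ip_dual_self w_def p_def by (auto simp: not_less)
    define S where "S = (\<Sum>j\<in>K. (ip n (dual n k M j) (M i))\<^sup>2)"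
    have "x M i \<le> (\<Sum>i<k. x M i)"
      using i(1) by (intro member_le_sum) (auto simp: x_def ip_self_nonneg)
    hence "x M i \<le> X M" unfolding X_def using iK by simp
    hence xi: "x M i \<le> real k * (real k + 1) / \<epsilon>" using MX by simp
    have nk: "real (card K) = real n - real k" using k by (simp add: cK)
    have "(\<Sum>j\<in>K. 1 / w M j) \<ge> real (card K) / ((real k + 2) / \<epsilon>)"
      using fK e MW iKj normal_pos[of n k M] iK
      by (intro sum_inverse_ge) (auto simp: W_def nk w_def K_def[symmetric])
    hence "p / 8 * (real (card K) / ((real k + 2) / \<epsilon>)) \<le> p / 8 * (\<Sum>j\<in>K. 1 / w M j)"
      using p by (intro mult_left_mono) auto
    also have "\<dots> \<le> S" using i(2) unfolding S_def .
    finally have S: "S \<ge> p / 8 * (real n - real k) * \<epsilon> / (real k + 2)" unfolding nk by simp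
    have s2: "s\<^sup>2 = p / (\<epsilon> ^ 4 * real n)"
      unfolding s_def p_def using n e by (simp add: power_divide power_mult_distrib power2_eq_square power4_eq_xxxx)
    \<comment> \<open>The origin of 96 = 8 * 6 * 2: 8 from the lower tail, 6 from k (k + 1) (k + 2)
      \<le> 6 k^3, and 2 from n - k \<ge> n / 2.\<close>
    have key: "8 * (real k * (real k + 1) * (real k + 2)) * \<epsilon>\<^sup>2 * real n \<le> p\<^sup>2 * (real n - real k)"
    proof -
      have k1: "1 \<le> real k" using k by simp
      have "real k * (real k + 1) * (real k + 2) \<le> real k * (2 * real k) * (3 * real k)"
        using k1 by (intro mult_mono) auto
      also have "\<dots> = 6 * real k ^ 3" by (simp add: power3_eq_cube)
      finally have "8 * (real k * (real k + 1) * (real k + 2)) * \<epsilon>\<^sup>2 * real n \<le> 8 * (6 * real k ^ 3) * \<epsilon>\<^sup>2 * real n"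
        by (intro mult_right_mono mult_left_mono) auto
      also have "\<dots> = (96 * real k ^ 3 * \<epsilon>\<^sup>2) * (real n / 2)" by simp
      also have "\<dots> \<le> p\<^sup>2 * (real n - real k)"
        using ke k unfolding p_def[symmetric] by (intro mult_mono) auto
      finally show ?thesis .
    qed
    have "real k * (real k + 1) / \<epsilon> \<le> s\<^sup>2 * (p / 8 * (real n - real k) * \<epsilon> / (real k + 2))"
    proof -
      have "real k * (real k + 1) / \<epsilon> = 8 * (real k * (real k + 1) * (real k + 2)) * \<epsilon>\<^sup>2 * real n / (8 * (real k + 2) * \<epsilon> ^ 3 * real n)"
        using e n by (simp add: power2_eq_square power3_eq_cube divide_simps)
      also have "\<dots> \<le> p\<^sup>2 * (real n - real k) / (8 * (real k + 2) * \<epsilon> ^ 3 * real n)"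
        using key e by (intro divide_right_mono) auto
      also have "\<dots> = s\<^sup>2 * (p / 8 * (real n - real k) * \<epsilon> / (real k + 2))"
        unfolding s2 using e n by (simp add: power2_eq_square power3_eq_cube power4_eq_xxxx divide_simps)
      finally show ?thesis .
    qed
    also have "\<dots> \<le> s\<^sup>2 * S" using S by (intro mult_left_mono) auto
    finally have "x M i \<le> s\<^sup>2 * S" using xi by simp
    thus ?thesis using i(1) k unfolding x_def S_def K_def
      by (intro smin_le_residual[OF True]) (auto simp: s_def)
  qed

  \<comment> \<open>The union bound as a pointwise inequality between indicator functions.\<close>
  have "1 - 2 * \<epsilon> - c ^ k \<le> avg (Mnd n d) (\<lambda>M. 1 - (if X M > real k * (real k + 1) / \<epsilon> then 1 else 0)
     - (if W M > (real n - real k) * (real k + 2) / \<epsilon> then 1 else 0) - (if B M then 1 else 0))"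
    unfolding avg_diff avg_Mnd_const[OF d] using PX PW PB by linarith
  also have "\<dots> \<le> avg (Mnd n d) (indicator {M. smin n M \<le> s})"
    by (rule avg_mono) (use good in \<open>auto simp: indicator_def not_less\<close>)
  also have "\<dots> = measure_pmf.prob (pmf_of_set (Mnd n d)) {M. smin n M \<le> s}"
    using finite_Mnd[OF d] Mnd_nonempty[OF d]
    by (subst measure_pmf_of_set) (simp_all add: avg_def indicator_def sum_of_bool_eq)
  finally show ?thesis unfolding s_def c_def p_def .
qed

section \<open>Choice of k and of the final constant\<close>

lemma geometric_times_square_bounded:
  fixes c :: real
  assumes "0 < c" "c \<le> 1"
  shows "(1 - c) ^ k \<le> (2 * exp c / c\<^sup>2) / (real k + 1)\<^sup>2"
proof -
  have "(1 - c) ^ k \<le> exp (- c) ^ k" using assms exp_ge_add_one_self[of "-c"] by (intro power_mono) auto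
  \<comment> \<open>Passing to k + 1 matches the upper bracket of k; the quadratic Taylor term
    suffices, since (k + 1)^-2 will be O(\<epsilon>).\<close>
  also have "\<dots> = exp c / exp (c * (real k + 1))"
    by (simp add: exp_of_nat_mult[symmetric] exp_diff[symmetric] algebra_simps)
  also have "\<dots> \<le> exp c / ((c * (real k + 1))\<^sup>2 / 2)"
  proof (rule divide_left_mono)
    have "0 \<le> c * (real k + 1)" using assms by simp
    thus "(c * (real k + 1))\<^sup>2 / 2 \<le> exp (c * (real k + 1))"
      using exp_lower_Taylor_quadratic[of "c * (real k + 1)"] by linarith
  qed (use assms in auto)
  also have "\<dots> = (2 * exp c / c\<^sup>2) / (real k + 1)\<^sup>2" by (simp add: power_mult_distrib)
  finally show ?thesis .
qed

lemma cube_bracket: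
  fixes x :: real
  assumes "0 \<le> x"
  obtains k :: nat where "real k ^ 3 \<le> x" "x < (real k + 1) ^ 3"
proof -
  define P where "P = (\<lambda>m :: nat. x < real m ^ 3)"
  obtain m :: nat where m: "x < real m" using reals_Archimedean2 by blast
  have "m \<le> m ^ 3" by (cases m) (auto intro: self_le_power)
  hence "real m \<le> real m ^ 3" by (metis of_nat_le_iff of_nat_power)
  hence "P m" using m unfolding P_def by linarith
  hence PL: "P (Least P)" by (rule LeastI)
  hence "Least P \<noteq> 0" using assms unfolding P_def by (intro notI) simp
  then obtain k where k: "Least P = Suc k" by (cases "Least P") auto
  hence "\<not> P k" using not_less_Least[of k P] by simp
  moreover have "P (Suc k)" using PL k by simp
  ultimately show thesis using that[of k] by (simp add: P_def add.commute)
qed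

lemma prob_smin_le_large_eps:
  fixes p :: real
  assumes p: "0 < p" "p \<le> 1/2" and d: "0 < d" "real d = p * real n" and e: "1 / sqrt (real d) \<le> \<epsilon>"
  defines "c \<equiv> p\<^sup>2 / 336"
  shows "measure_pmf.prob (pmf_of_set (Mnd n d)) {M. smin n M \<le> sqrt (real d) / (\<epsilon>\<^sup>2 * real n)}
    \<ge> 1 - (2 + (2 * exp c / c\<^sup>2 + 1) * (10 / p)) * \<epsilon>"
proof -
  \<comment> \<open>With k^3 \<epsilon>^2 \<le> g^2 = p^2 / 100 the condition with constant 96 in
    \<open>prob_smin_le\<close> holds.\<close>
  define g where "g = p / 10"
  define C3 where "C3 = 2 * exp c / c\<^sup>2"
  have n: "0 < n" using d by (intro gr0I) auto
  have pdn: "real d / real n = p" using d(2) n by simp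
  have "2 * real d \<le> real n" using d p n by (simp add: mult_right_mono[of p "1/2" "real n", simplified])
  hence d2: "2 * d \<le> n" by linarith
  have g: "0 < g" using p by (simp add: g_def)
  have e0: "0 < \<epsilon>" using e d(1) by (smt (verit) divide_pos_pos of_nat_0_less_iff real_sqrt_gt_zero)
  have "p\<^sup>2 \<le> 1" using p by (simp add: power_le_one)
  hence c: "0 < c" "c \<le> 1" unfolding c_def using p by auto
  have C3: "0 < C3" unfolding C3_def using c by simp
  obtain k :: nat where k: "real k ^ 3 \<le> (g / \<epsilon>)\<^sup>2" "(g / \<epsilon>)\<^sup>2 < (real k + 1) ^ 3"
    using cube_bracket[of "(g / \<epsilon>)\<^sup>2"] by auto
  \<comment> \<open>Weakening the cube to a fourth power allows taking a square root.\<close>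
  have "(g / \<epsilon>)\<^sup>2 < ((real k + 1)\<^sup>2)\<^sup>2"
  proof -
    have "(real k + 1) ^ 3 \<le> (real k + 1) ^ 4" by (intro power_increasing) auto
    thus ?thesis using k(2) by (simp add: power_mult[symmetric])
  qed
  hence "g / \<epsilon> < (real k + 1)\<^sup>2" by (rule power2_less_imp_less) simp
  hence ge: "1 / (real k + 1)\<^sup>2 \<le> \<epsilon> / g" using e0 g by (simp add: field_simps)
  have expand: "(2 + (C3 + 1) * (1 / g)) * \<epsilon> = 2 * \<epsilon> + C3 * (\<epsilon> / g) + \<epsilon> / g"
    by (simp add: algebra_simps add_divide_distrib)
  have bound: "2 * \<epsilon> + C3 / (real k + 1)\<^sup>2 \<le> (2 + (C3 + 1) * (1 / g)) * \<epsilon>"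
  proof -
    have "C3 * (1 / (real k + 1)\<^sup>2) \<le> C3 * (\<epsilon> / g)" using ge C3 by (intro mult_left_mono) auto
    moreover have "0 \<le> \<epsilon> / g" using e0 g by simp
    ultimately show ?thesis unfolding expand by simp
  qed
  have "1 - (2 + (C3 + 1) * (1 / g)) * \<epsilon> \<le>
    measure_pmf.prob (pmf_of_set (Mnd n d)) {M. smin n M \<le> sqrt (real d) / (\<epsilon>\<^sup>2 * real n)}"
  \<comment> \<open>For k = 0 one has \<epsilon> \<ge> g and the claimed lower bound is not
    positive.\<close>
  proof (cases "k = 0")
    case True
    hence "1 \<le> \<epsilon> / g" using ge by simp
    also have "\<dots> \<le> (2 + (C3 + 1) * (1 / g)) * \<epsilon>" unfolding expand using C3 e0 g by simp
    finally have "1 - (2 + (C3 + 1) * (1 / g)) * \<epsilon> \<le> 0" by simp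
    thus ?thesis by (rule order_trans) simp
  next
    case False
    hence k1: "1 \<le> real k" by simp
    have "(1 / sqrt (real d))\<^sup>2 \<le> \<epsilon>\<^sup>2" using e by (intro power_mono) auto
    hence "1 \<le> \<epsilon>\<^sup>2 * real d" using d(1) by (simp add: power_divide field_simps)
    hence de: "1 / \<epsilon>\<^sup>2 \<le> real d" using e0 by (simp add: field_simps)
    \<comment> \<open>Here \<epsilon> \<ge> 1 / sqrt d enters: k \<le> g^2 / \<epsilon>^2 \<le> n /
      4, and then 2 (k + 1) \<le> 4 k \<le> n.\<close>
    have "real k \<le> real k ^ 3" using k1 by (simp add: self_le_power)
    also have "\<dots> \<le> g\<^sup>2 * (1 / \<epsilon>\<^sup>2)" using k(1) by (simp add: power_divide)
    also have "\<dots> \<le> (1 / 4) * real n"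
    proof (rule mult_mono)
      show "g\<^sup>2 \<le> 1 / 4" unfolding g_def using \<open>p\<^sup>2 \<le> 1\<close> by (simp add: power_divide)
      show "1 / \<epsilon>\<^sup>2 \<le> real n" using de \<open>2 * real d \<le> real n\<close> by linarith
    qed auto
    finally have "2 * (real k + 1) \<le> real n" using k1 by (simp add: field_simps)
    hence "real (2 * (k + 1)) \<le> real n" by simp
    hence "2 * (k + 1) \<le> n" by (simp only: of_nat_le_iff)
    moreover have "96 * real k ^ 3 * \<epsilon>\<^sup>2 \<le> (real d / real n)\<^sup>2"
    proof -
      have "real k ^ 3 * \<epsilon>\<^sup>2 \<le> (g / \<epsilon>)\<^sup>2 * \<epsilon>\<^sup>2" using k(1) by (intro mult_right_mono) auto
      also have "\<dots> = p\<^sup>2 / 100" using e0 by (simp add: power_divide g_def)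
      finally show ?thesis unfolding pdn using zero_le_power2[of p] by linarith
    qed
    ultimately have "1 - 2 * \<epsilon> - (1 - c) ^ k \<le>
        measure_pmf.prob (pmf_of_set (Mnd n d)) {M. smin n M \<le> sqrt (real d) / (\<epsilon>\<^sup>2 * real n)}"
      using prob_smin_le[OF d(1) d2, of k \<epsilon>] False e0 unfolding pdn c_def by simp
    thus ?thesis using geometric_times_square_bounded[OF c, of k] bound unfolding C3_def by linarith
  qed
  thus ?thesis by (simp add: g_def C3_def)
qed

theorem theorem1p1:
  fixes p :: real
  assumes "0 < p" and "p \<le> 1/2"
  shows "\<exists>C>0. \<forall>n d::nat. 0 < n \<longrightarrow> 0 < d \<longrightarrow> real d = p * real n \<longrightarrow>
           (\<forall>\<epsilon>>0. measure_pmf.prob (pmf_of_set (Mnd n d))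
                        {M. smin n M \<le> sqrt (real d) / (\<epsilon>\<^sup>2 * real n)}
                     \<ge> 1 - C * (\<epsilon> + 1 / sqrt (real d)))"
proof -
  define C where "C = 2 + (2 * exp (p\<^sup>2 / 336) / (p\<^sup>2 / 336)\<^sup>2 + 1) * (10 / p)"
  have C: "C > 0" unfolding C_def using assms by (intro add_pos_nonneg mult_nonneg_nonneg) auto
  show ?thesis
  proof (intro exI[of _ C] conjI C allI impI)
    fix n d :: nat and \<epsilon> :: real
    assume n: "0 < n" and d: "0 < d" "real d = p * real n" and e: "0 < \<epsilon>"
    \<comment> \<open>Decreasing \<epsilon> raises the threshold and enlarges the event, so values
      below 1 / sqrt d inherit the bound at 1 / sqrt d.\<close>
    define \<delta> where "\<delta> = max \<epsilon> (1 / sqrt (real d))"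
    have \<delta>: "\<epsilon> \<le> \<delta>" "1 / sqrt (real d) \<le> \<delta>" "\<delta> \<le> \<epsilon> + 1 / sqrt (real d)"
      using e by (auto simp: \<delta>_def)
    have "1 - C * (\<epsilon> + 1 / sqrt (real d)) \<le> 1 - C * \<delta>" using C \<delta> by simp
    also have "\<dots> \<le> measure_pmf.prob (pmf_of_set (Mnd n d)) {M. smin n M \<le> sqrt (real d) / (\<delta>\<^sup>2 * real n)}"
      unfolding C_def by (rule prob_smin_le_large_eps[OF assms d \<delta>(2)])
    also have "\<dots> \<le> measure_pmf.prob (pmf_of_set (Mnd n d)) {M. smin n M \<le> sqrt (real d) / (\<epsilon>\<^sup>2 * real n)}"
    proof (rule measure_pmf.finite_measure_mono)
      have "sqrt (real d) / (\<delta>\<^sup>2 * real n) \<le> sqrt (real d) / (\<epsilon>\<^sup>2 * real n)"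
        using \<delta>(1) e n by (intro divide_left_mono mult_right_mono power_mono) auto
      thus "{M. smin n M \<le> sqrt (real d) / (\<delta>\<^sup>2 * real n)} \<subseteq> {M. smin n M \<le> sqrt (real d) / (\<epsilon>\<^sup>2 * real n)}"
        by auto
    qed simp
    finally show "1 - C * (\<epsilon> + 1 / sqrt (real d)) \<le>
      measure_pmf.prob (pmf_of_set (Mnd n d)) {M. smin n M \<le> sqrt (real d) / (\<epsilon>\<^sup>2 * real n)}" .
  qed
qed

end
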